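(* Let $m$ be a positive integer and let $H$ be a tropical curve which is admissible, i.e. the minimal lattice width of its Newton polygon is at least $m$. Let $P\in H$ be a vertex of $H$ and suppose that $\mu^{\mathrm{trop}}_P(H)=m$ (multiplicity in the intermediate sense). Then $\mathrm{area}^{*}(\mathfrak{Infl}(P))\ge\frac38 m^2$ and $\mathrm{area}(\mathfrak{Infl}(P))\ge\frac12 m^2$, that is, $$\sum_{V\in\mathfrak I(P)}\mathrm{area}(d(V))\ge\frac38m^2\qquad\text{and}\qquad \mathrm{area}(d(P))+\sum_{V\in\mathfrak I(P)}\mathrm{area}(d(V))\ge\frac12m^2 .$$
   Context: Tropical curves. Let $\mathcal A\subset\mathbb Z^2$ be finite and non-empty, $c_{ij}\in\mathbb R$ for $(i,j)\in\mathcal A$, and $f(X,Y)=\max_{(i,j)\in\mathcal A}(iX+jY+c_{ij})$. The tropical curve $H$ defined by $f$ is the set of points of $\mathbb R^2$ where this maximum is attained for at least two $(i,j)\in\mathcal A$. Its Newton polygon is $\Delta=\mathrm{ConvHull}(\mathcal A)$. For $Q=(Q_1,Q_2)\in\mathbb R^2$ let $d(Q)$ be the convex hull of those $(i,j)\in\mathcal A$ with $iQ_1+jQ_2+c_{ij}=f(Q)$. A point $Q\in H$ is a vertex of $H$ if $d(Q)$ is 2-dimensional; the edges of $H$ are the closures of the connected components of $H$ minus its vertices. For an edge $E$, $d(E)$ denotes the segment $d(Q)$ for any $Q$ in the relative interior of $E$; the weight of $E$ is the lattice length of $d(E)$. A tropical curve is regarded together with the weights of its edges; then $f$ is determined, up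 to adding an integer affine function $iX+jY+c$ and up to coefficients that do not influence $f$, and all notions below do not depend on the choice of $f$. Directions, width. $P(\mathbb Z^2)$ is the set of directions in $\mathbb Z^2$; each direction $u$ is represented by a primitive vector $(u_1,u_2)\in\mathbb Z^2$, $\gcd(u_1,u_2)=1$, unique up to sign. For compact $B\subset\mathbb R^2$, the lattice width in direction $u$ is $\omega_u(B)=\max_{x,y\in B}(u_1,u_2)\cdot(x-y)$, and the minimal lattice width is $\omega(B)=\min_{u\in P(\mathbb Z^2)}\omega_u(B)$. The lattice length of a segment parallel to a primitive integer vector $(p,q)$ is its Euclidean length divided by $\sqrt{p^2+q^2}$. $m$-thickness. A compact set $B\subset\mathbb R^2$ is $m$-thick if one of the following holds: $B$ is empty; $\mathrm{ConvHull}(B)$ is 1-dimensional, of rational slope (vertical allowed), with lattice length at least $m$; $\mathrm{ConvHull}(B)$ is 2-dimensional and for each $u\in P(\mathbb Z^2)$ with $\omega_u(\mathrm{ConvHull}(B))=m-a_u$, $a_u>0$, $\mathrm{ConvHull}(B)$ has two sides perpendicular to $u$, each of lattice length at least $a_u$. Multiplicity in the intermediate sense. Suppose first $P=(0,0)\in H$. Let $\widetilde{\mathcal A}=\mathrm{ConvHull}\{(i,j,s): (i,j)\in\mathcal A,\ s\le c_{ij}\}\subset\mathbb R^3$ (the extended Newton polyhedron) and for $\mu\in\mathbb R$ let $\widetilde{\mathcal A}_\mu$ be the projection to the first two coordinates of the section of $\widetilde{\mathcal A}$ by the plane $z=\mu$. Then $P$ is of multiplicity at least $m$ on $H$ in the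 intermediate sense, written $\mu^{\mathrm{trop}}_P(H)\ge m$, if $\widetilde{\mathcal A}_\mu$ is $m$-thick for every $\mu\in\mathbb R$. For general $P=(P_1,P_2)\in H$ one translates $P$ to the origin, i.e. replaces $c_{ij}$ by $c_{ij}+iP_1+jP_2$. We write $\mu^{\mathrm{trop}}_P(H)=m$ if $\mu^{\mathrm{trop}}_P(H)\ge m$ holds but $\mu^{\mathrm{trop}}_P(H)\ge m+1$ does not. Influenced set. For $Q\in H$ and $u\in P(\mathbb Z^2)$ let $l_Q(u)$ be the line through $Q$ in direction $u$, let $E_Q(u)$ (the long edge) be the connected component of $H\cap l_Q(u)$ containing $Q$, and let $\mathfrak I_Q(u)$ be the set of vertices of $H$ lying on $E_Q(u)$. Put $\mathfrak I(Q)=\bigcup_{u\in P(\mathbb Z^2)}\mathfrak I_Q(u)$ (a set, not a multiset: it contains $Q$ only once if $Q$ is a vertex), and let $\mathfrak{Infl}(Q)$ be the collection of faces $d(V)$, $V\in\mathfrak I(Q)$. If $Q$ is a vertex of $H$, $\mathrm{area}^{*}(\mathfrak{Infl}(Q))=\sum_{V\in\mathfrak I(Q)}\mathrm{area}(d(V))$ and $\mathrm{area}(\mathfrak{Infl}(Q))=\mathrm{area}^{*}(\mathfrak{Infl}(Q))+\mathrm{area}(d(Q))$. *)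

theory Defs
  imports "HOL-Analysis.Analysis"
begin

definition real_vec :: "int \<times> int \<Rightarrow> real \<times> real" where
  "real_vec a = (real_of_int (fst a), real_of_int (snd a))"


section \<open>Tropical curves\<close>

text \<open>A tropical polynomial is given by a finite non-empty set \<open>A\<close> of exponents and
  coefficients \<open>c\<close>; only the values of \<open>c\<close> on \<open>A\<close> are used.\<close>

definition trop_monomial :: "(int \<times> int \<Rightarrow> real) \<Rightarrow> real \<times> real \<Rightarrow> int \<times> int \<Rightarrow> real" where
  "trop_monomial c Q a = real_of_int (fst a) * fst Q + real_of_int (snd a) * snd Q + c a"

definition trop_poly :: "(int \<times> int) set \<Rightarrow> (int \<times> int \<Rightarrow> real) \<Rightarrow> real \<times> real \<Rightarrow> real" where
  "trop_poly A c Q = Max (trop_monomial c Q ` A)"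

definition maximal_exponents ::
    "(int \<times> int) set \<Rightarrow> (int \<times> int \<Rightarrow> real) \<Rightarrow> real \<times> real \<Rightarrow> (int \<times> int) set" where
  "maximal_exponents A c Q = {a \<in> A. trop_monomial c Q a = trop_poly A c Q}"

definition trop_curve :: "(int \<times> int) set \<Rightarrow> (int \<times> int \<Rightarrow> real) \<Rightarrow> (real \<times> real) set" where
  "trop_curve A c = {Q. card (maximal_exponents A c Q) \<ge> 2}"

definition newton_polygon :: "(int \<times> int) set \<Rightarrow> (real \<times> real) set" where
  "newton_polygon A = convex hull (real_vec ` A)"

definition dual_face ::
    "(int \<times> int) set \<Rightarrow> (int \<times> int \<Rightarrow> real) \<Rightarrow> real \<times> real \<Rightarrow> (real \<times> real) set" where
  "dual_face A c Q = convex hull (real_vec ` maximal_exponents A c Q)"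

definition trop_vertices :: "(int \<times> int) set \<Rightarrow> (int \<times> int \<Rightarrow> real) \<Rightarrow> (real \<times> real) set" where
  "trop_vertices A c = {Q \<in> trop_curve A c. aff_dim (dual_face A c Q) = 2}"


section \<open>Directions and lattice width\<close>

text \<open>A direction of the lattice is represented by both of its primitive vectors \<open>u\<close> and
  \<open>-u\<close>; everything below is invariant under this change of sign.\<close>

definition primitive :: "int \<times> int \<Rightarrow> bool" where
  "primitive u \<longleftrightarrow> gcd (fst u) (snd u) = 1"

text \<open>Used for non-empty compact \<open>B\<close> only, where the supremum is a maximum.\<close>

definition lattice_width :: "int \<times> int \<Rightarrow> (real \<times> real) set \<Rightarrow> real" where
  "lattice_width u B = (SUP (x, y) \<in> B \<times> B. real_vec u \<bullet> (x - y))"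

definition min_lattice_width :: "(real \<times> real) set \<Rightarrow> real" where
  "min_lattice_width B = (INF u \<in> Collect primitive. lattice_width u B)"

definition parallel_to :: "int \<times> int \<Rightarrow> (real \<times> real) set \<Rightarrow> bool" where
  "parallel_to u S \<longleftrightarrow> (\<forall>x\<in>S. \<forall>y\<in>S. \<exists>t. x - y = t *\<^sub>R real_vec u)"

text \<open>Lattice length of a segment \<open>S\<close> that is parallel to the primitive vector \<open>u\<close>.\<close>

definition lattice_length :: "int \<times> int \<Rightarrow> (real \<times> real) set \<Rightarrow> real" where
  "lattice_length u S = diameter S / norm (real_vec u)"

definition perp :: "int \<times> int \<Rightarrow> int \<times> int" where
  "perp u = (- snd u, fst u)"


section \<open>Thickness and multiplicity in the intermediate sense\<close>

definition thick :: "nat \<Rightarrow> (real \<times> real) set \<Rightarrow> bool" where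
  "thick m B \<longleftrightarrow>
     B = {} \<or>
     (aff_dim (convex hull B) = 1 \<and>
       (\<exists>u. primitive u \<and> parallel_to u (convex hull B) \<and>
            lattice_length u (convex hull B) \<ge> real m)) \<or>
     (aff_dim (convex hull B) = 2 \<and>
       (\<forall>u a. primitive u \<and> a > 0 \<and> lattice_width u (convex hull B) = real m - a \<longrightarrow>
         (\<exists>S T. S \<noteq> T \<and>
            S edge_of (convex hull B) \<and> parallel_to (perp u) S \<and>
            lattice_length (perp u) S \<ge> a \<and>
            T edge_of (convex hull B) \<and> parallel_to (perp u) T \<and>
            lattice_length (perp u) T \<ge> a)))"

definition extended_newton_polyhedron ::
    "(int \<times> int) set \<Rightarrow> (int \<times> int \<Rightarrow> real) \<Rightarrow> (real \<times> real \<times> real) set" where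
  "extended_newton_polyhedron A c =
     convex hull {(real_of_int i, real_of_int j, s) | i j s. (i, j) \<in> A \<and> s \<le> c (i, j)}"

definition polyhedron_section ::
    "(int \<times> int) set \<Rightarrow> (int \<times> int \<Rightarrow> real) \<Rightarrow> real \<Rightarrow> (real \<times> real) set" where
  "polyhedron_section A c \<mu> = {(x, y). (x, y, \<mu>) \<in> extended_newton_polyhedron A c}"

text \<open>The coefficients of the curve translated so that \<open>P\<close> becomes the origin are
  the values \<open>trop_monomial c P\<close>.\<close>

definition trop_mult_ge ::
    "(int \<times> int) set \<Rightarrow> (int \<times> int \<Rightarrow> real) \<Rightarrow> real \<times> real \<Rightarrow> nat \<Rightarrow> bool" where
  "trop_mult_ge A c P m \<longleftrightarrow> (\<forall>\<mu>. thick m (polyhedron_section A (trop_monomial c P) \<mu>))"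

definition trop_mult_eq ::
    "(int \<times> int) set \<Rightarrow> (int \<times> int \<Rightarrow> real) \<Rightarrow> real \<times> real \<Rightarrow> nat \<Rightarrow> bool" where
  "trop_mult_eq A c P m \<longleftrightarrow> trop_mult_ge A c P m \<and> \<not> trop_mult_ge A c P (m + 1)"


section \<open>The influenced set\<close>

definition dir_line :: "real \<times> real \<Rightarrow> int \<times> int \<Rightarrow> (real \<times> real) set" where
  "dir_line Q u = {Q + t *\<^sub>R real_vec u | t. True}"

definition long_edge ::
    "(int \<times> int) set \<Rightarrow> (int \<times> int \<Rightarrow> real) \<Rightarrow> real \<times> real \<Rightarrow> int \<times> int \<Rightarrow> (real \<times> real) set" where
  "long_edge A c Q u = connected_component_set (trop_curve A c \<inter> dir_line Q u) Q"

definition influenced_dir ::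
    "(int \<times> int) set \<Rightarrow> (int \<times> int \<Rightarrow> real) \<Rightarrow> real \<times> real \<Rightarrow> int \<times> int \<Rightarrow> (real \<times> real) set" where
  "influenced_dir A c Q u = trop_vertices A c \<inter> long_edge A c Q u"

definition influenced ::
    "(int \<times> int) set \<Rightarrow> (int \<times> int \<Rightarrow> real) \<Rightarrow> real \<times> real \<Rightarrow> (real \<times> real) set" where
  "influenced A c Q = (\<Union>u \<in> Collect primitive. influenced_dir A c Q u)"

definition area :: "(real \<times> real) set \<Rightarrow> real" where
  "area B = measure lebesgue B"

definition infl_area_star ::
    "(int \<times> int) set \<Rightarrow> (int \<times> int \<Rightarrow> real) \<Rightarrow> real \<times> real \<Rightarrow> real" where
  "infl_area_star A c Q = (\<Sum>V \<in> influenced A c Q. area (dual_face A c V))"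

text \<open>For a vertex \<open>Q\<close>, the face dual to \<open>Q\<close> is thus counted twice.\<close>

definition infl_area ::
    "(int \<times> int) set \<Rightarrow> (int \<times> int \<Rightarrow> real) \<Rightarrow> real \<times> real \<Rightarrow> real" where
  "infl_area A c Q = infl_area_star A c Q + area (dual_face A c Q)"

text \<open>A tropical curve has finitely many vertices, so that the sum above is a genuine one.\<close>

lemma finite_trop_vertices:
  assumes "finite A"
  shows "finite (trop_vertices A c)"
proof (rule inj_on_finite[where f = "maximal_exponents A c" and B = "Pow A"])
  show "maximal_exponents A c ` trop_vertices A c \<subseteq> Pow A"
    by (auto simp: maximal_exponents_def)
  show "finite (Pow A)" using assms by simp
  show "inj_on (maximal_exponents A c) (trop_vertices A c)"
  proof (rule inj_onI, rule ccontr)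
    fix Q R
    assume Q: "Q \<in> trop_vertices A c"
      and eq: "maximal_exponents A c Q = maximal_exponents A c R" and ne: "Q \<noteq> R"
    define w where "w = Q - R"
    have w: "w \<noteq> 0" using ne by (simp add: w_def)
    define r where "r = trop_poly A c Q - trop_poly A c R"
    have "w \<bullet> real_vec a = r" if "a \<in> maximal_exponents A c Q" for a
    proof -
      have "trop_monomial c Q a = trop_poly A c Q"
        using that by (simp add: maximal_exponents_def)
      moreover have "trop_monomial c R a = trop_poly A c R"
        using that unfolding eq by (simp add: maximal_exponents_def)
      ultimately show ?thesis
        by (simp add: w_def r_def trop_monomial_def real_vec_def inner_prod_def algebra_simps)
    qed
    hence "real_vec ` maximal_exponents A c Q \<subseteq> {x. w \<bullet> x = r}" by auto
    hence "dual_face A c Q \<subseteq> {x. w \<bullet> x = r}"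
      unfolding dual_face_def by (intro hull_minimal convex_hyperplane)
    hence "aff_dim (dual_face A c Q) \<le> aff_dim {x. w \<bullet> x = r}" by (rule aff_dim_subset)
    also have "\<dots> = 1" using w by simp
    finally show False using Q by (simp add: trop_vertices_def)
  qed
qed

lemma finite_influenced:
  assumes "finite A"
  shows "finite (influenced A c Q)"
  by (rule finite_subset[OF _ finite_trop_vertices[OF assms, of c]])
    (auto simp: influenced_def influenced_dir_def)

end

theory Submission
  imports Defs
begin

text \<open>Let \<open>D = d(P)\<close>, and for a direction \<open>u\<close> let \<open>a\<^sub>u = max 0 (m - \<omega>\<^sub>u(D))\<close> be its defect.

  Long edges. As the level \<open>\<mu>\<close> decreases from its top value, where the section of the extended
  Newton polyhedron is \<open>D\<close>, the width of the section in direction \<open>u\<close> grows from \<open>m - a\<^sub>u\<close> to at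
  least \<open>m\<close>. By thickness a section of width at most \<open>m - y\<close> has two sides perpendicular to \<open>u\<close> of
  lattice length at least \<open>y\<close>; these sides sweep the faces dual to the points of \<open>E\<^sub>P(u)\<close>. Integrating
  over \<open>y\<close> shows that the vertices other than \<open>P\<close> on \<open>E\<^sub>P(u)\<close> contribute an area of at least
  \<open>a\<^sub>u\<^sup>2 / 2\<close>.

  The face \<open>D\<close>. Choose \<open>u\<close> of minimal width \<open>w\<close>, so that \<open>m = w + a\<close> if \<open>w \<le> m\<close>. The two sides perpendicular to
  \<open>u\<close> span a parallelogram of area \<open>a w\<close>. In suitable lattice coordinates \<open>u, v\<close> its slope is
  \<open>\<sigma> \<in> [0, 1]\<close>, and the widths of \<open>D\<close> in the directions \<open>v\<close> and \<open>v - u\<close>, together with the sides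
  perpendicular to \<open>v\<close>, bound the area of the parts of \<open>D\<close> above and below the parallelogram. The
  resulting inequality for \<open>area D + (a\<^sub>u\<^sup>2 + a\<^sub>v\<^sup>2 + a\<^sub>v\<^sub>-\<^sub>u\<^sup>2) / 2\<close> contains the Fejes Toth-Makai bound
  \<open>area D \<ge> 3/8 \<omega>(D)\<^sup>2\<close> as the case of vanishing defects.\<close>


section \<open>Area and slices\<close>

lemma emeasure_lborel_slices:
  fixes S :: "(real \<times> real) set"
  assumes "S \<in> sets borel"
  shows "emeasure lborel S = (\<integral>\<^sup>+x. emeasure lborel {y. (x, y) \<in> S} \<partial>lborel)"
proof -
  have "S \<in> sets (lborel \<Otimes>\<^sub>M lborel)" unfolding lborel_prod using assms by simp
  from lborel.emeasure_pair_measure_alt[OF this] show ?thesis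
    by (simp add: lborel_prod vimage_def)
qed

lemma emeasure_lborel_slices_swap:
  fixes S :: "(real \<times> real) set"
  assumes "S \<in> sets borel"
  shows "emeasure lborel S = (\<integral>\<^sup>+y. emeasure lborel {x. (x, y) \<in> S} \<partial>lborel)"
proof -
  have "S \<in> sets (lborel \<Otimes>\<^sub>M lborel)" unfolding lborel_prod using assms by simp
  from lborel_pair.emeasure_pair_measure_alt2[OF this] show ?thesis
    by (simp add: lborel_prod vimage_def)
qed

text \<open>\<open>T\<close> is arbitrary: a translate of a non-Borel set is non-Borel, and then
  both sides are 0. Slices can thus be shifted without a measurability check.\<close>

lemma emeasure_lborel_translate:
  fixes T :: "real set"
  shows "emeasure lborel {y. y + d \<in> T} = emeasure lborel T"
proof (cases "T \<in> sets borel")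
  case True
  have "emeasure lborel T = emeasure (distr lborel borel ((+) d)) T"
    by (simp add: lborel_distr_plus)
  also have "\<dots> = emeasure lborel ((+) d -` T \<inter> space lborel)"
    using True by (intro emeasure_distr) auto
  also have "(+) d -` T \<inter> space lborel = {y. y + d \<in> T}" by (auto simp: add.commute)
  finally show ?thesis by simp
next
  case False
  have "{y. y + d \<in> T} \<notin> sets borel"
  proof
    assume "{y. y + d \<in> T} \<in> sets borel"
    hence "(\<lambda>y. y - d) -` {y. y + d \<in> T} \<inter> space borel \<in> sets borel"
      by (intro measurable_sets[of _ borel borel]) auto
    also have "(\<lambda>y. y - d) -` {y. y + d \<in> T} \<inter> space borel = T" by auto
    finally show False using False by simp
  qed
  thus ?thesis using False by (simp add: emeasure_notin_sets)
qed

section \<open>Linear maps of determinant 1 preserve area\<close>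

definition lin2 :: "real \<Rightarrow> real \<Rightarrow> real \<Rightarrow> real \<Rightarrow> real \<times> real \<Rightarrow> real \<times> real" where
  "lin2 a b c d z = (a * fst z + b * snd z, c * fst z + d * snd z)"

lemma lin2_compose:
  "lin2 a b c d (lin2 a' b' c' d' z) =
     lin2 (a * a' + b * c') (a * b' + b * d') (c * a' + d * c') (c * b' + d * d') z"
  by (simp add: lin2_def algebra_simps)

lemma continuous_lin2: "continuous_on S (lin2 a b c d)"
  unfolding lin2_def by (intro continuous_intros)

lemma lin2_vimage_borel: "S \<in> sets borel \<Longrightarrow> lin2 a b c d -` S \<in> sets borel"
  using measurable_sets[OF borel_measurable_continuous_onI[OF continuous_lin2], of S a b c d] by simp

lemma emeasure_vimage_shear_lower:
  assumes "S \<in> sets borel"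
  shows "emeasure lborel (lin2 1 0 k 1 -` S) = emeasure lborel S"
proof -
  have "emeasure lborel {y. (x, y) \<in> lin2 1 0 k 1 -` S} = emeasure lborel {y. (x, y) \<in> S}" for x
    using emeasure_lborel_translate[of "k * x" "{y. (x, y) \<in> S}"]
    by (simp add: lin2_def add.commute)
  thus ?thesis
    using emeasure_lborel_slices[OF assms] emeasure_lborel_slices[OF lin2_vimage_borel[OF assms], of 1 0 k 1]
    by simp
qed

lemma emeasure_vimage_shear_upper:
  assumes "S \<in> sets borel"
  shows "emeasure lborel (lin2 1 k 0 1 -` S) = emeasure lborel S"
proof -
  have "emeasure lborel {x. (x, y) \<in> lin2 1 k 0 1 -` S} = emeasure lborel {x. (x, y) \<in> S}" for y
    using emeasure_lborel_translate[of "k * y" "{x. (x, y) \<in> S}"]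
    by (simp add: lin2_def add.commute)
  thus ?thesis
    using emeasure_lborel_slices_swap[OF assms]
      emeasure_lborel_slices_swap[OF lin2_vimage_borel[OF assms], of 1 k 0 1]
    by simp
qed

text \<open>A matrix of determinant 1 is a product of shears.\<close>

lemma emeasure_vimage_lin2:
  assumes S: "S \<in> sets borel" and det: "a * d - b * c = 1"
  shows "emeasure lborel (lin2 a b c d -` S) = emeasure lborel S"
proof -
  have *: "emeasure lborel (lin2 a b c d -` S) = emeasure lborel S"
    if det: "a * d - b * c = 1" and b: "b \<noteq> 0" for a b c d
  proof -
    have c: "c = (a * d - 1) / b" using det b by (simp add: field_simps)
    \<comment> \<open>The middle shear has the entry \<open>b\<close>; the other two are forced by
      the diagonal entries \<open>d\<close> and \<open>a\<close>, and the determinant then gives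
      \<open>c\<close>.\<close>
    have "lin2 a b c d z = lin2 1 0 ((d - 1) / b) 1 (lin2 1 b 0 1 (lin2 1 0 ((a - 1) / b) 1 z))" for z
    proof -
      have "b * ((a * d - 1) / b) = a * d - 1" "b * ((a - 1) / b) = a - 1" "(d - 1) / b * b = d - 1"
        using b by simp_all
      moreover have "(d - 1) / b + a * ((d - 1) / b) - (d - 1) / b + (a - 1) / b = (a * d - 1) / b"
        by (simp add: add_divide_distrib[symmetric] diff_divide_distrib[symmetric] algebra_simps)
      ultimately show ?thesis
        unfolding lin2_compose c by (simp add: algebra_simps)
    qed
    hence "lin2 a b c d -` S =
        lin2 1 0 ((a - 1) / b) 1 -` lin2 1 b 0 1 -` lin2 1 0 ((d - 1) / b) 1 -` S" by auto
    thus ?thesis using S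
      by (simp add: emeasure_vimage_shear_lower emeasure_vimage_shear_upper lin2_vimage_borel)
  qed
  show ?thesis
  proof (cases "b = 0")
    case True
    \<comment> \<open>Splitting off a shear on the right leaves the upper right entry
      \<open>a\<close>, which is non-zero because \<open>a * d = 1\<close>.\<close>
    have "lin2 a b c d z = lin2 a a c (c + d) (lin2 1 (-1) 0 1 z)" for z
      unfolding lin2_compose True by simp
    hence "lin2 a b c d -` S = lin2 1 (-1) 0 1 -` lin2 a a c (c + d) -` S" by auto
    moreover have "a * (c + d) - a * c = 1" "a \<noteq> 0" using det True by (auto simp: algebra_simps)
    ultimately show ?thesis
      using *[of a "c + d" a c] S by (simp add: emeasure_vimage_shear_upper lin2_vimage_borel)
  qed (use * det in blast)
qed

lemma emeasure_image_lin2: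
  assumes "compact K" and det: "a * d - b * c = 1"
  shows "emeasure lborel (lin2 a b c d ` K) = emeasure lborel K"
proof -
  \<comment> \<open>The adjugate is the inverse, since the determinant is 1.\<close>
  have "lin2 d (-b) (-c) a (lin2 a b c d z) = z" for z
  proof -
    have "lin2 d (-b) (-c) a (lin2 a b c d z) = lin2 (a*d-b*c) 0 0 (a*d-b*c) z"
      unfolding lin2_compose by (simp add: algebra_simps)
    thus ?thesis using det by (simp add: lin2_def)
  qed
  hence "inj (lin2 a b c d)" by (metis injI)
  hence "lin2 a b c d -` lin2 a b c d ` K = K" by (rule inj_vimage_image_eq)
  moreover have "lin2 a b c d ` K \<in> sets borel"
    using compact_continuous_image[OF continuous_lin2 assms(1)] by (intro borel_compact)
  ultimately show ?thesis using emeasure_vimage_lin2[OF _ det] by metis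
qed

lemma area_eq_emeasure: "compact K \<Longrightarrow> emeasure lborel K = ennreal (area K)"
proof -
  assume K: "compact K"
  hence "K \<in> sets lborel" by (simp add: borel_compact)
  hence "area K = measure lborel K" by (simp add: area_def measure_completion)
  thus ?thesis using emeasure_compact_finite[OF K] by (simp add: emeasure_eq_ennreal_measure less_top)
qed

lemma area_image_lin2:
  assumes "compact K" and det: "a * d - b * c = 1"
  shows "area (lin2 a b c d ` K) = area K"
proof -
  have "compact (lin2 a b c d ` K)"
    using compact_continuous_image[OF continuous_lin2 assms(1)] .
  hence "ennreal (area (lin2 a b c d ` K)) = ennreal (area K)"
    using emeasure_image_lin2[OF assms] area_eq_emeasure assms(1) by metis
  thus ?thesis by (simp add: area_def)
qed

lemma area_nonneg: "area K \<ge> 0" by (simp add: area_def)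

section \<open>Areas of compact bodies from the lengths of their vertical slices\<close>

definition slice :: "(real \<times> real) set \<Rightarrow> real \<Rightarrow> real set" where
  "slice K x = {y. (x, y) \<in> K}"

lemma compact_slice: "compact K \<Longrightarrow> compact (slice K x)"
proof -
  assume K: "compact K"
  have "slice K x = snd ` (K \<inter> ({x} \<times> UNIV))" unfolding slice_def by force
  moreover have "compact (K \<inter> ({x} \<times> UNIV))"
    by (intro compact_Int_closed K closed_Times) auto
  ultimately show ?thesis by (auto intro!: compact_continuous_image continuous_intros)
qed

definition slice_length :: "(real \<times> real) set \<Rightarrow> real \<Rightarrow> real" where
  "slice_length K x = measure lborel (slice K x)"

lemma slice_length_nonneg: "slice_length K x \<ge> 0" by (simp add: slice_length_def)

lemma emeasure_slice: "compact K \<Longrightarrow> emeasure lborel (slice K x) = ennreal (slice_length K x)"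
  unfolding slice_length_def
  using emeasure_compact_finite[OF compact_slice, of K x]
  by (simp add: emeasure_eq_ennreal_measure less_top)

lemma slice_length_measurable:
  assumes "compact K" shows "slice_length K \<in> borel_measurable borel"
proof -
  have "K \<in> sets (lborel \<Otimes>\<^sub>M lborel)"
    unfolding lborel_prod using assms by (simp add: borel_compact)
  from lborel.measurable_emeasure_Pair[OF this]
  have "(\<lambda>x. emeasure lborel (slice K x)) \<in> borel_measurable lborel"
    by (simp add: slice_def vimage_def)
  hence "(\<lambda>x. enn2real (emeasure lborel (slice K x))) \<in> borel_measurable lborel" by measurable
  thus ?thesis by (simp add: slice_length_def[abs_def] measure_def)
qed

lemma nn_integral_slice_length:
  assumes "compact K"
  shows "(\<integral>\<^sup>+x. ennreal (slice_length K x) \<partial>lborel) = ennreal (area K)"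
  using emeasure_lborel_slices[OF borel_compact[OF assms]] assms
  by (simp add: emeasure_slice area_eq_emeasure flip: slice_def)

lemma slice_length_has_integral:
  assumes "compact K"
  shows "(slice_length K has_integral area K) UNIV"
  using nn_integral_slice_length[OF assms] slice_length_measurable[OF assms]
  by (intro nn_integral_has_integral) (auto simp: slice_length_nonneg area_nonneg)

lemma slice_length_ge:
  assumes K: "compact K" "convex K" and "(x, y) \<in> K" "(x, y') \<in> K"
  shows "slice_length K x \<ge> \<bar>y - y'\<bar>"
proof -
  have *: "slice_length K x \<ge> y' - y" if "(x, y) \<in> K" "(x, y') \<in> K" "y \<le> y'" for y y'
  proof -
    have "{y..y'} \<subseteq> slice K x"
    proof
      fix z assume z: "z \<in> {y..y'}"
      have "closed_segment (x, y) (x, y') \<subseteq> K" using that K(2) by (simp add: closed_segment_subset)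
      moreover have "(x, z) \<in> closed_segment (x, y) (x, y')"
        using z by (simp add: closed_segment_PairD closed_segment_eq_real_ivl closed_segment_same_fst
             that(3))
      ultimately show "z \<in> slice K x" by (auto simp: slice_def)
    qed
    hence "emeasure lborel {y..y'} \<le> emeasure lborel (slice K x)"
      by (intro emeasure_mono) (auto intro: borel_compact compact_slice K)
    thus ?thesis using that K by (simp add: emeasure_slice slice_length_nonneg)
  qed
  show ?thesis using *[of y y'] *[of y' y] assms by linarith
qed

text \<open>Layer-cake formula: the integral of \<open>s\<close> is the integral over
  \<open>y \<ge> 0\<close> of the measure of \<open>{h. y \<le> s h}\<close>, hence at least that of
  \<open>a - y\<close> over \<open>{0..a}\<close>.\<close>

lemma nn_integral_ge_half_square:
  fixes s :: "real \<Rightarrow> real"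
  assumes s[measurable]: "s \<in> borel_measurable borel" and "\<And>h. s h \<ge> 0" and "a \<ge> 0"
    and lev: "\<And>y. 0 < y \<Longrightarrow> y < a \<Longrightarrow> emeasure lborel {h. y \<le> s h} \<ge> ennreal (a - y)"
  shows "(\<integral>\<^sup>+h. ennreal (s h) \<partial>lborel) \<ge> ennreal (a\<^sup>2 / 2)"
proof -
  define I :: "real \<Rightarrow> real \<Rightarrow> ennreal" where "I h y = indicator {(h, y). 0 \<le> y \<and> y \<le> s h} (h, y)" for h y
  have I[measurable]: "case_prod I \<in> borel_measurable (lborel \<Otimes>\<^sub>M lborel)"
    unfolding I_def by measurable
  have 1: "(\<integral>\<^sup>+y. I h y \<partial>lborel) = ennreal (s h)" for h
  proof -
    have "I h = indicator {0..s h}" by (auto simp: I_def indicator_def fun_eq_iff)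
    thus ?thesis using assms(2)[of h] by simp
  qed
  have 2: "(\<integral>\<^sup>+h. I h y \<partial>lborel) = emeasure lborel {h. y \<le> s h}" if "y \<ge> 0" for y
  proof -
    have "(\<lambda>h. I h y) = indicator {h. y \<le> s h}" using that by (auto simp: I_def indicator_def fun_eq_iff)
    moreover have "{h. y \<le> s h} \<in> sets lborel" using s by measurable
    ultimately show ?thesis by simp
  qed
  have "ennreal (a\<^sup>2 / 2) = (\<integral>\<^sup>+y. ennreal (a - y) * indicator {0..a} y \<partial>lborel)"
  proof -
    have "((\<lambda>y. a * y - y\<^sup>2 / 2) has_real_derivative a - x) (at x)" for x
      by (auto intro!: derivative_eq_intros)
    hence "(\<integral>\<^sup>+y. ennreal (a - y) * indicator {0..a} y \<partial>lborel) = ennreal ((a * a - a\<^sup>2 / 2) - (a * 0 - 0\<^sup>2 / 2))"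
      using assms(3) by (intro nn_integral_FTC_Icc) (auto intro: DERIV_subset)
    thus ?thesis by (simp add: power2_eq_square)
  qed
  also have "\<dots> \<le> (\<integral>\<^sup>+y. (\<integral>\<^sup>+h. I h y \<partial>lborel) \<partial>lborel)"
  proof (rule nn_integral_mono_AE)
    \<comment> \<open>The hypothesis \<open>lev\<close> says nothing at \<open>y = 0\<close>, a null
      set; at \<open>y = a\<close> the integrand is 0.\<close>
    have "AE y in lborel. y \<noteq> (0::real)" by (rule AE_lborel_singleton)
    thus "AE y in lborel. ennreal (a - y) * indicator {0..a} y \<le> (\<integral>\<^sup>+h. I h y \<partial>lborel)"
    proof eventually_elim
      case (elim y)
      show ?case
      proof (cases "0 < y \<and> y < a")
        case True
        thus ?thesis using lev[of y] 2[of y] by simp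
      next
        case False
        thus ?thesis using elim by (cases "y = a") (auto simp: indicator_def)
      qed
    qed
  qed
  also have "\<dots> = (\<integral>\<^sup>+h. (\<integral>\<^sup>+y. I h y \<partial>lborel) \<partial>lborel)"
    by (rule lborel_pair.Fubini'[OF I])
  finally show ?thesis by (simp add: 1)
qed

text \<open>Only the total slice length over \<open>h\<close> enters, so different levels
  \<open>h\<close> may be covered by different bodies.\<close>

lemma sum_area_ge_half_square:
  assumes "finite F" and "\<And>V. V \<in> F \<Longrightarrow> compact (K V)" and "a \<ge> 0"
    and lev: "\<And>y. 0 < y \<Longrightarrow> y < a \<Longrightarrow>
      emeasure lborel {h. y \<le> (\<Sum>V\<in>F. slice_length (K V) h)} \<ge> ennreal (a - y)"
  shows "(\<Sum>V\<in>F. area (K V)) \<ge> a\<^sup>2 / 2"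
proof -
  have "ennreal (a\<^sup>2 / 2) \<le> (\<integral>\<^sup>+h. ennreal (\<Sum>V\<in>F. slice_length (K V) h) \<partial>lborel)"
    using assms by (intro nn_integral_ge_half_square borel_measurable_sum)
      (auto simp: slice_length_measurable slice_length_nonneg sum_nonneg)
  also have "\<dots> = (\<integral>\<^sup>+h. (\<Sum>V\<in>F. ennreal (slice_length (K V) h)) \<partial>lborel)"
    by (simp add: slice_length_nonneg)
  also have "\<dots> = (\<Sum>V\<in>F. \<integral>\<^sup>+h. ennreal (slice_length (K V) h) \<partial>lborel)"
    using assms by (intro nn_integral_sum) (auto intro!: slice_length_measurable measurable_compose[OF _ measurable_ennreal])
  also have "\<dots> = ennreal (\<Sum>V\<in>F. area (K V))"
    using assms(2) by (simp add: nn_integral_slice_length area_nonneg)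
  finally show ?thesis by (simp add: sum_nonneg area_nonneg)
qed

section \<open>Polygonal chains in a convex body\<close>

text \<open>Some graph over \<open>[\<alpha>, \<beta>]\<close> that lies in \<open>K\<close> has integral \<open>I\<close>; for an upper and a lower chain, the
  difference of the integrals bounds the area of \<open>K\<close> from below.\<close>

definition chain :: "(real \<times> real) set \<Rightarrow> real \<Rightarrow> real \<Rightarrow> real \<Rightarrow> bool" where
  "chain K \<alpha> \<beta> I \<longleftrightarrow> \<alpha> \<le> \<beta> \<and> (\<exists>U. (\<forall>x\<in>{\<alpha>..\<beta>}. (x, U x) \<in> K) \<and> (U has_integral I) {\<alpha>..\<beta>})"

lemma chain_segment:
  assumes "convex K" "(\<alpha>, y) \<in> K" "(\<beta>, z) \<in> K" "\<alpha> \<le> \<beta>"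
  shows "chain K \<alpha> \<beta> ((\<beta> - \<alpha>) * (y + z) / 2)"
proof -
  \<comment> \<open>For \<open>\<alpha> = \<beta>\<close> division by zero gives slope 0, so
    \<open>U\<close> is the constant \<open>y\<close> and the degenerate segment is covered as
    well.\<close>
  define U where "U x = y + (x - \<alpha>) * ((z - y) / (\<beta> - \<alpha>))" for x
  have "(x, U x) \<in> K" if x: "x \<in> {\<alpha>..\<beta>}" for x
  proof (cases "\<alpha> = \<beta>")
    case True
    thus ?thesis using x assms by (auto simp: U_def)
  next
    case False
    define r where "r = (x - \<alpha>) / (\<beta> - \<alpha>)"
    have r: "0 \<le> r" "r \<le> 1" using x False by (auto simp: r_def)
    have xr: "x = (1 - r) * \<alpha> + r * \<beta>" using False x by (simp add: r_def divide_simps) (simp add: algebra_simps)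
    have "U x = y + r * (z - y)" by (simp add: U_def r_def)
    hence "(x, U x) = ((1 - r) * \<alpha> + r * \<beta>, y + r * (z - y))" using xr by simp
    hence "(x, U x) = (1 - r) *\<^sub>R (\<alpha>, y) + r *\<^sub>R (\<beta>, z)" by (simp add: algebra_simps)
    thus ?thesis using convexD_alt[OF assms(1-3) r] by argo
  qed
  moreover have "(U has_integral ((\<beta> - \<alpha>) * (y + z) / 2)) {\<alpha>..\<beta>}"
  proof -
    define k where "k = (z - y) / (\<beta> - \<alpha>)"
    have "((\<lambda>x. (y - k * \<alpha>) + k * x) has_integral ((\<beta> - \<alpha>) * (y - k * \<alpha>) + k * ((\<beta>\<^sup>2 - \<alpha>\<^sup>2) / 2))) {\<alpha>..\<beta>}"
      using has_integral_const_real[of "y - k * \<alpha>" \<alpha> \<beta>] assms(4)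
      by (intro has_integral_add has_integral_mult_right ident_has_integral) auto
    moreover have "(\<lambda>x. (y - k * \<alpha>) + k * x) = U"
      by (simp add: U_def k_def[symmetric] fun_eq_iff algebra_simps)
    moreover have "(\<beta> - \<alpha>) * (y - k * \<alpha>) + k * ((\<beta>\<^sup>2 - \<alpha>\<^sup>2) / 2) = (\<beta> - \<alpha>) * (y + z) / 2"
    proof (cases "\<alpha> = \<beta>")
      case False
      hence "k * (\<beta> - \<alpha>) = z - y" by (simp add: k_def)
      moreover have "(\<beta> - \<alpha>) * (y - k * \<alpha>) + k * ((\<beta>\<^sup>2 - \<alpha>\<^sup>2) / 2) = (\<beta> - \<alpha>) * (2 * y + k * (\<beta> - \<alpha>)) / 2"
        by (simp add: power2_eq_square field_simps)
      ultimately show ?thesis by simp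
    qed simp
    ultimately show ?thesis by (simp only:)
  qed
  ultimately show ?thesis using assms(4) unfolding chain_def by blast
qed

lemma chain_join:
  assumes "chain K \<alpha> \<beta> I" "chain K \<beta> \<gamma> J"
  shows "chain K \<alpha> \<gamma> (I + J)"
proof -
  from assms obtain U V where
    U: "\<forall>x\<in>{\<alpha>..\<beta>}. (x, U x) \<in> K" "(U has_integral I) {\<alpha>..\<beta>}" "\<alpha> \<le> \<beta>" and
    V: "\<forall>x\<in>{\<beta>..\<gamma>}. (x, V x) \<in> K" "(V has_integral J) {\<beta>..\<gamma>}" "\<beta> \<le> \<gamma>"
    unfolding chain_def by blast
  define W where "W x = (if x < \<beta> then U x else V x)" for x
  have "(W has_integral I) {\<alpha>..\<beta>}"
    by (rule has_integral_spike_finite[OF _ _ U(2), of "{\<beta>}"]) (auto simp: W_def)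
  moreover have "(W has_integral J) {\<beta>..\<gamma>}"
    by (rule has_integral_spike_finite[OF _ _ V(2), of "{}"]) (auto simp: W_def)
  ultimately have "(W has_integral (I + J)) {\<alpha>..\<gamma>}"
    using U V by (intro has_integral_combine)
  moreover have "\<forall>x\<in>{\<alpha>..\<gamma>}. (x, W x) \<in> K" using U V by (auto simp: W_def)
  ultimately show ?thesis using U(3) V(3) unfolding chain_def by (meson order_trans)
qed

text \<open>By convexity the slice over \<open>x\<close> contains the interval between the two
  graphs, so their difference, whatever its sign, is at most the slice length.\<close>

lemma area_ge_chain_diff:
  assumes K: "compact K" "convex K" and "chain K \<alpha> \<beta> I" "chain K \<alpha> \<beta> J"
  shows "area K \<ge> I - J"
proof -
  from assms obtain U V where
    U: "\<forall>x\<in>{\<alpha>..\<beta>}. (x, U x) \<in> K" "(U has_integral I) {\<alpha>..\<beta>}" and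
    V: "\<forall>x\<in>{\<alpha>..\<beta>}. (x, V x) \<in> K" "(V has_integral J) {\<alpha>..\<beta>}"
    unfolding chain_def by blast
  have "((\<lambda>x. U x - V x) has_integral (I - J)) {\<alpha>..\<beta>}"
    using U V by (intro has_integral_diff)
  hence "((\<lambda>x. if x \<in> {\<alpha>..\<beta>} then U x - V x else 0) has_integral (I - J)) UNIV"
    by (simp only: has_integral_restrict_UNIV)
  moreover have "(if x \<in> {\<alpha>..\<beta>} then U x - V x else 0) \<le> slice_length K x" for x
    using slice_length_ge[OF K, of x "U x" "V x"] U V slice_length_nonneg[of K x] by auto
  ultimately show ?thesis
    using slice_length_has_integral[OF K(1)] by (meson has_integral_le)
qed

section \<open>Convex bodies with two parallel sides\<close>

text \<open>A half of the body is the part above the segment from \<open>(0, 0)\<close> to \<open>(w, \<sigma> w)\<close>; \<open>p\<close> and \<open>q\<close> are the maxima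
  of \<open>y\<close> and of \<open>y - x\<close> on it. Twice its area is smallest either if both maxima are attained at the
  corner \<open>(p - q, p)\<close>, prolonged by a horizontal side of length \<open>b\<close>, or if they are attained at
  \<open>(w, p)\<close> and \<open>(0, q)\<close>.\<close>

definition peak_bound :: "real \<Rightarrow> real \<Rightarrow> real \<Rightarrow> real \<Rightarrow> real \<Rightarrow> real" where
  "peak_bound w \<sigma> b p q = w * ((1 - \<sigma>) * p + \<sigma> * q) + b * (p - \<sigma> * w)"

definition corner_bound :: "real \<Rightarrow> real \<Rightarrow> real \<Rightarrow> real \<Rightarrow> real" where
  "corner_bound w \<sigma> p q = w * (p + q - \<sigma> * w)"

lemma peak_bound_mono:
  assumes "0 \<le> w" "0 \<le> \<sigma>" "\<sigma> \<le> 1" "0 \<le> b" "p \<le> p'" "q \<le> q'"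
  shows "peak_bound w \<sigma> b p q \<le> peak_bound w \<sigma> b p' q'"
  unfolding peak_bound_def using assms
  by (intro add_mono mult_left_mono) auto

lemma corner_bound_mono:
  assumes "0 \<le> w" "p \<le> p'" "q \<le> q'"
  shows "corner_bound w \<sigma> p q \<le> corner_bound w \<sigma> p' q'"
  unfolding corner_bound_def using assms by (intro mult_left_mono) auto

text \<open>The left-hand side is twice the area under the polygonal line through \<open>(0, 0)\<close>, \<open>(t', q + t')\<close>,
  \<open>(t, p)\<close> and \<open>(w, \<sigma> w)\<close>, less that under the segment. It is affine in \<open>t\<close> and in \<open>t'\<close>, so that its
  minimum is attained at a corner of the admissible rectangle.\<close>

lemma half_area_bound:
  fixes w \<sigma> p q b t t' :: real
  assumes \<sigma>: "0 \<le> \<sigma>" "\<sigma> \<le> 1" and "0 \<le> w" and t': "0 \<le> t'" "t' \<le> p - q"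
    and t: "p - q + b \<le> t" "t \<le> w" and p: "\<sigma> * w \<le> p" and q: "0 \<le> q" and b: "0 \<le> b"
  shows "t * (q - \<sigma> * w) + t * t' + (w - t') * p \<ge>
    min (peak_bound w \<sigma> b (min p w) (min q (\<sigma> * w))) (corner_bound w \<sigma> (min p w) (min q (\<sigma> * w)))"
    (is "?E \<ge> min ?T ?P")
proof (cases "q - \<sigma> * w + t' \<ge> 0")
  case True
  \<comment> \<open>The coefficient of \<open>t\<close> is non-negative: \<open>t\<close> is lowered
    to its least value \<open>p - q + b\<close>.\<close>
  have "(t - (p - q + b)) * (q - \<sigma> * w + t') \<ge> 0" using True t by simp
  hence E: "?E \<ge> (p - q + b) * (q - \<sigma> * w + t') + (w - t') * p" by (simp add: algebra_simps)
  show ?thesis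
  proof (cases "b \<le> q")
    case True
    \<comment> \<open>The coefficient of \<open>t'\<close> has become \<open>b - q \<le> 0\<close>:
      \<open>t'\<close> is raised to \<open>p - q\<close>, where the value is exactly
      \<open>peak_bound\<close>.\<close>
    have "(p - q - t') * (q - b) \<ge> 0" using True t' by simp
    hence "(p - q + b) * (q - \<sigma> * w + t') + (w - t') * p \<ge> peak_bound w \<sigma> b p q"
      by (simp add: peak_bound_def algebra_simps)
    moreover have "peak_bound w \<sigma> b p q \<ge> ?T" using assms by (intro peak_bound_mono) auto
    ultimately show ?thesis using E by linarith
  next
    case False
    \<comment> \<open>Now the coefficient of \<open>t'\<close> is positive and \<open>t'\<close> is
      lowered to 0.\<close>
    have "t' * (b - q) \<ge> 0" using False t' by simp
    hence E: "?E \<ge> (p - q + b) * (q - \<sigma> * w) + w * p" using E by (simp add: algebra_simps)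
    show ?thesis
    proof (cases "q \<le> \<sigma> * w")
      case True
      \<comment> \<open>The factor \<open>p - q + b\<close> multiplies a non-positive number and may
        be enlarged to \<open>w\<close>.\<close>
      have "(w - (p - q + b)) * (\<sigma> * w - q) \<ge> 0" using True t by simp
      hence "?E \<ge> corner_bound w \<sigma> p q" using E by (simp add: corner_bound_def algebra_simps)
      moreover have "corner_bound w \<sigma> p q \<ge> ?P" using assms by (intro corner_bound_mono) auto
      ultimately show ?thesis by linarith
    next
      case False
      have "(p - q + b) * (q - \<sigma> * w) \<ge> 0" using False t' b by simp
      hence "?E \<ge> corner_bound w \<sigma> p (\<sigma> * w)" using E by (simp add: corner_bound_def)
      moreover have "corner_bound w \<sigma> p (\<sigma> * w) \<ge> ?P" using assms by (intro corner_bound_mono) auto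
      ultimately show ?thesis by linarith
    qed
  qed
next
  case False
  \<comment> \<open>The coefficient of \<open>t\<close> is negative: \<open>t\<close> is raised to
    \<open>w\<close>. What remains has the coefficient \<open>w - p\<close> at
    \<open>t'\<close>.\<close>
  have "(w - t) * (\<sigma> * w - q - t') \<ge> 0" using False t by simp
  hence E: "?E \<ge> w * (q - \<sigma> * w) + w * p + t' * (w - p)" by (simp add: algebra_simps)
  show ?thesis
  proof (cases "p \<le> w")
    case True
    have "t' * (w - p) \<ge> 0" using True t' by simp
    hence "?E \<ge> corner_bound w \<sigma> p q" using E by (simp add: corner_bound_def algebra_simps)
    moreover have "corner_bound w \<sigma> p q \<ge> ?P" using assms by (intro corner_bound_mono) auto
    ultimately show ?thesis by linarith
  next
    case False
    \<comment> \<open>Here \<open>t'\<close> is raised to its upper bound \<open>w\<close>, which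
      amounts to replacing \<open>p\<close> by \<open>w\<close>.\<close>
    have "(p - w) * (w - t') \<ge> 0" using False t' t b by simp
    hence "?E \<ge> corner_bound w \<sigma> w q" using E by (simp add: corner_bound_def algebra_simps)
    moreover have "corner_bound w \<sigma> w q \<ge> ?P" using assms by (intro corner_bound_mono) auto
    ultimately show ?thesis by linarith
  qed
qed

text \<open>This is the case where the constant 3/8 is attained: all defects 0,
  \<open>\<sigma> = 1/2\<close>, \<open>p = w\<close>, \<open>q = q' + \<sigma> * w\<close>,
  \<open>q' = 0\<close>, \<open>p' = \<sigma> * w\<close>. The bounds are minimised over
  \<open>q\<close>, \<open>q'\<close>, then over \<open>p\<close>, \<open>p'\<close>, and the rest
  is completion of squares.\<close>

lemma mixed_halves_bound:
  fixes w a b b' \<sigma> p q p' q' :: real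
  assumes \<sigma>: "0 \<le> \<sigma>" "\<sigma> \<le> 1" and w: "0 \<le> w" and a: "0 \<le> a"
    and b: "0 \<le> b" "b \<le> a" and b': "0 \<le> b'" "b' \<le> a"
    and p: "\<sigma> * w \<le> p" "p \<le> w" and p': "\<sigma> * w \<le> p'" "p' \<le> w"
    and q: "0 \<le> q" "q \<le> \<sigma> * w" and q': "0 \<le> q'" "q' \<le> \<sigma> * w"
    and pp: "p + p' \<ge> (1 + \<sigma>) * w - b" and qq: "q + q' \<ge> \<sigma> * w - b'"
  shows "a * w + (peak_bound w \<sigma> b p q + corner_bound w \<sigma> p' q') / 2 + (a\<^sup>2 + b\<^sup>2 + b'\<^sup>2) / 2
           \<ge> 3 / 8 * (w + a)\<^sup>2"
proof -
  define X where "X = peak_bound w \<sigma> b p q + corner_bound w \<sigma> p' q'"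
  have X: "X = (w * ((1 - \<sigma>) * p) + b * (p - \<sigma> * w) + w * p') + w * (\<sigma> * q + q') - \<sigma> * w * w"
    by (simp add: X_def peak_bound_def corner_bound_def algebra_simps)
  \<comment> \<open>Since \<open>\<sigma> \<le> 1\<close>, the weighted sum is least when
    \<open>q\<close> carries the whole required sum \<open>\<sigma> * w - b'\<close>.\<close>
  have "\<sigma> * q + q' \<ge> \<sigma> * (\<sigma> * w - b')"
  proof (cases "q \<le> \<sigma> * w - b'")
    case True
    hence "(1 - \<sigma>) * q \<le> (1 - \<sigma>) * (\<sigma> * w - b')" using \<sigma> by (intro mult_left_mono) auto
    thus ?thesis using qq by (simp add: algebra_simps)
  next
    case False
    hence "\<sigma> * q \<ge> \<sigma> * (\<sigma> * w - b')" using \<sigma> by (intro mult_left_mono) auto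
    thus ?thesis using q' by simp
  qed
  hence Q: "w * (\<sigma> * q + q') \<ge> w * (\<sigma> * (\<sigma> * w - b'))" using w by (rule mult_left_mono)
  have sq: "(w + a)\<^sup>2 = w * w + 2 * (a * w) + a * a" by (simp add: power2_eq_square algebra_simps)
  have wb': "w * \<sigma> * b' \<le> w * \<sigma> * a" using w \<sigma> b' by (intro mult_left_mono) auto
  show ?thesis
  proof (cases "b \<le> \<sigma> * w")
    case True
    \<comment> \<open>Along \<open>p + p' = (1 + \<sigma>) * w - b\<close> the slope in
      \<open>p\<close> is \<open>b - \<sigma> * w \<le> 0\<close>. The minimum is where
      \<open>p'\<close> reaches its lower bound \<open>\<sigma> * w\<close>, at
      \<open>p = w - b\<close>; beyond that the expression grows with \<open>p\<close>.\<close>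
    have "w * ((1 - \<sigma>) * p) + b * (p - \<sigma> * w) + w * p' \<ge> w * w - b * b"
    proof (cases "p \<le> w - b")
      case pl: True
      have "(\<sigma> * w - b) * (w - b - p) \<ge> 0" using True pl by simp
      moreover have "w * p' \<ge> w * ((1 + \<sigma>) * w - b - p)" using pp w by (intro mult_left_mono) auto
      ultimately show ?thesis by (simp add: algebra_simps)
    next
      case False
      have "w * (1 - \<sigma>) * (p - (w - b)) \<ge> 0" "b * (p - (w - b)) \<ge> 0" using False \<sigma> w b by auto
      moreover have "w * p' \<ge> w * (\<sigma> * w)" using p' w by (intro mult_left_mono) auto
      ultimately show ?thesis by (simp add: algebra_simps)
    qed
    hence X1: "X \<ge> w * w - b * b + w * (\<sigma> * (\<sigma> * w - b')) - \<sigma> * w * w" using X Q by linarith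
    \<comment> \<open>Once \<open>b'\<close> is replaced by \<open>a\<close>, the loss is the
      product of \<open>w * \<sigma>\<close> and \<open>w + a - w * \<sigma>\<close>, at most a
      quarter of the square of their sum.\<close>
    have "((w + a) / 2 - w * \<sigma>)\<^sup>2 \<ge> 0" by simp
    hence "(w + a)\<^sup>2 / 4 \<ge> w * \<sigma> * (w + a - w * \<sigma>)"
      by (simp add: power2_eq_square field_simps)
    hence "X + b * b \<ge> w * w - (w * w + 2 * (a * w) + a * a) / 4"
      using X1 wb' unfolding sq by (simp add: field_simps)
    moreover have "b' * b' \<ge> 0" by simp
    \<comment> \<open>\<open>W\<close>, \<open>Y\<close>, \<open>Z\<close>, \<open>B\<close>,
      \<open>B'\<close> stand for the monomials \<open>w * w\<close>, \<open>a * a\<close>,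
      \<open>a * w\<close>, \<open>b * b\<close>, \<open>b' * b'\<close>, which makes the last step
      linear. The same device recurs below.\<close>
    moreover have "3 / 8 * (W + 2 * Z + Y) \<le> Z + X / 2 + (Y + B + B') / 2"
      if "X + B \<ge> W - (W + 2 * Z + Y) / 4" "B' \<ge> 0" for W Y Z B B'
      using that by (simp add: field_simps)
    ultimately show ?thesis unfolding X_def[symmetric] sq unfolding power2_eq_square by blast
  next
    case False
    \<comment> \<open>The slope in \<open>p\<close> is now positive, so \<open>p\<close> is lowered
      to \<open>\<sigma> * w\<close>, with \<open>p' = w - b\<close>.\<close>
    have "(b - \<sigma> * w) * (p - \<sigma> * w) \<ge> 0" using False p by simp
    moreover have "w * p' \<ge> w * ((1 + \<sigma>) * w - b - p)" using pp w by (intro mult_left_mono) auto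
    ultimately have "w * ((1 - \<sigma>) * p) + b * (p - \<sigma> * w) + w * p' \<ge>
        w * w + \<sigma> * w * w - \<sigma> * w * (\<sigma> * w) - w * b"
      by (simp add: algebra_simps)
    hence X1: "X \<ge> w * w - w * b - \<sigma> * w * b'" using X Q by (simp add: algebra_simps)
    have "\<sigma> * w * b' \<le> b * b'" using False b' by (intro mult_right_mono) auto
    \<comment> \<open>The weights are chosen so that the available \<open>b' * b'\<close> is used up
      exactly and part of \<open>b * b\<close> is left.\<close>
    moreover have "(b' - b / 2)\<^sup>2 \<ge> 0" by simp
    hence "b * b' \<le> b' * b' + b * b / 4" by (simp add: power2_eq_square field_simps)
    moreover have "b * b \<le> a * b" using b by (intro mult_right_mono) auto
    moreover have "(w + a - 2 * b)\<^sup>2 \<ge> 0" by simp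
    hence "4 * (w * b) + 4 * (a * b) \<le> w * w + 2 * (a * w) + a * a + 4 * (b * b)"
      by (simp add: power2_eq_square field_simps)
    moreover have "b * b \<ge> 0" by simp
    moreover have "3 / 8 * (W + 2 * Z + Y) \<le> Z + X / 2 + (Y + B + B') / 2"
      if "X \<ge> W - C - E" "E \<le> F" "F \<le> B' + B / 4" "B \<le> G" "4 * C + 4 * G \<le> W + 2 * Z + Y + 4 * B" "B \<ge> 0"
      for W Y Z B B' C E F G
      using that by (simp add: field_simps)
    ultimately show ?thesis using X1 unfolding X_def[symmetric] sq unfolding power2_eq_square by blast
  qed
qed

text \<open>\<open>S\<close> stands for the area of the body, \<open>X\<close> and \<open>X'\<close>
  for twice the areas of its upper and lower halves. The first claim is settled for each combination
  of the two extremal shapes; the second needs only crude bounds for each half.\<close>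

lemma two_halves_bound:
  fixes w a b b' \<sigma> p q p' q' X X' S :: real
  assumes \<sigma>: "0 \<le> \<sigma>" "\<sigma> \<le> 1" and w: "0 \<le> w" and a: "0 \<le> a"
    and b: "0 \<le> b" "b \<le> a" and b': "0 \<le> b'" "b' \<le> a"
    and p: "\<sigma> * w \<le> p" "p \<le> w" and p': "\<sigma> * w \<le> p'" "p' \<le> w"
    and q: "0 \<le> q" "q \<le> \<sigma> * w" and q': "0 \<le> q'" "q' \<le> \<sigma> * w"
    and pp: "p + p' \<ge> (1 + \<sigma>) * w - b" and qq: "q + q' \<ge> \<sigma> * w - b'"
    and X: "X \<ge> min (peak_bound w \<sigma> b p q) (corner_bound w \<sigma> p q)"
    and X': "X' \<ge> min (peak_bound w \<sigma> b p' q') (corner_bound w \<sigma> p' q')"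
    and S: "S \<ge> a * w + (X + X') / 2"
  shows "S + (a\<^sup>2 + b\<^sup>2 + b'\<^sup>2) / 2 \<ge> 3 / 8 * (w + a)\<^sup>2" and "2 * S + a\<^sup>2 / 2 \<ge> (w + a)\<^sup>2 / 2"
proof -
  have sq: "(w + a)\<^sup>2 = w * w + 2 * (a * w) + a * a" by (simp add: power2_eq_square algebra_simps)
  have final: "M \<le> S + N" if "S \<ge> Z + (X + X') / 2" "M \<le> Z + Y / 2 + N" "Y \<le> X + X'" for M N Y Z
    using that by (simp add: field_simps)
  consider (TT) "X \<ge> peak_bound w \<sigma> b p q" "X' \<ge> peak_bound w \<sigma> b p' q'"
    | (TP) "X \<ge> peak_bound w \<sigma> b p q" "X' \<ge> corner_bound w \<sigma> p' q'"
    | (PT) "X \<ge> corner_bound w \<sigma> p q" "X' \<ge> peak_bound w \<sigma> b p' q'"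
    | (PP) "X \<ge> corner_bound w \<sigma> p q" "X' \<ge> corner_bound w \<sigma> p' q'"
    using X X' by linarith
  thus "S + (a\<^sup>2 + b\<^sup>2 + b'\<^sup>2) / 2 \<ge> 3 / 8 * (w + a)\<^sup>2"
  proof cases
    case TT
    have "b * (p - \<sigma> * w) \<ge> 0" "b * (p' - \<sigma> * w) \<ge> 0" using b p p' by auto
    hence "X + X' \<ge> w * ((1 - \<sigma>) * (p + p') + \<sigma> * (q + q'))"
      using TT by (simp add: peak_bound_def algebra_simps)
    \<comment> \<open>With \<open>b\<close> and \<open>b'\<close> enlarged to \<open>a\<close>, the
      parameter \<open>\<sigma>\<close> cancels and \<open>w - a\<close> remains.\<close>
    moreover have "(1 - \<sigma>) * (p + p') + \<sigma> * (q + q') \<ge> (1 - \<sigma>) * ((1 + \<sigma>) * w - a) + \<sigma> * (\<sigma> * w - a)"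
      using \<sigma> pp qq b b' by (intro add_mono mult_left_mono) auto
    hence "w * ((1 - \<sigma>) * (p + p') + \<sigma> * (q + q')) \<ge> w * ((1 - \<sigma>) * ((1 + \<sigma>) * w - a) + \<sigma> * (\<sigma> * w - a))"
      using w by (rule mult_left_mono)
    moreover have "(1 - \<sigma>) * ((1 + \<sigma>) * w - a) + \<sigma> * (\<sigma> * w - a) = w - a" by (simp add: algebra_simps)
    ultimately have "X + X' \<ge> w * w - a * w" by (simp add: algebra_simps)
    moreover have "(a - w)\<^sup>2 \<ge> 0" by simp
    hence "2 * (a * w) \<le> a * a + w * w" by (simp add: power2_eq_square algebra_simps)
    moreover have "b * b \<ge> 0" "b' * b' \<ge> 0" by simp_all
    moreover have "3 / 8 * (W + 2 * Z + Y) \<le> S + (Y + B + B') / 2"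
      if "W - Z \<le> X + X'" "2 * Z \<le> Y + W" "B \<ge> 0" "B' \<ge> 0" "S \<ge> Z + (X + X') / 2" for W Y Z B B'
      using that by (simp add: field_simps)
    ultimately show ?thesis using S unfolding sq unfolding power2_eq_square by blast
  next
    case TP
    from add_mono[OF this] have "peak_bound w \<sigma> b p q + corner_bound w \<sigma> p' q' \<le> X + X'" .
    from final[OF S mixed_halves_bound[OF \<sigma> w a b b' p p' q q' pp qq] this] show ?thesis .
  next
    case PT
    have "p' + p \<ge> (1 + \<sigma>) * w - b" "q' + q \<ge> \<sigma> * w - b'" using pp qq by auto
    note * = mixed_halves_bound[OF \<sigma> w a b b' p' p q' q this]
    have "peak_bound w \<sigma> b p' q' + corner_bound w \<sigma> p q \<le> X + X'" using PT by simp
    from final[OF S * this] show ?thesis .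
  next
    case PP
    have "w * (p + p') \<ge> w * ((1 + \<sigma>) * w - b)" "w * (q + q') \<ge> w * (\<sigma> * w - b')"
      using pp qq w by (auto intro!: mult_left_mono)
    hence XX: "X + X' \<ge> w * w - w * b - w * b'"
      using PP by (simp add: corner_bound_def algebra_simps)
    \<comment> \<open>Each defect costs \<open>w * x\<close> and returns \<open>x * x\<close>. As
      \<open>x \<le> a\<close>, the balance is at most \<open>x * (w + a) - 2 * x * x\<close>, which
      is largest at \<open>x = (w + a) / 4\<close>.\<close>
    have *: "w * x - x * x \<le> (w + a)\<^sup>2 / 8" if "0 \<le> x" "x \<le> a" for x
    proof -
      have "x * w \<le> x * (w + a - x)" using that by (intro mult_left_mono) auto
      moreover have "(x - (w + a) / 4)\<^sup>2 \<ge> 0" by simp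
      ultimately show ?thesis by (simp add: power2_eq_square field_simps)
    qed
    have "3 / 8 * M \<le> S + (Y + B + B') / 2"
      if "C - B \<le> M / 8" "C' - B' \<le> M / 8" "X + X' \<ge> W - C - C'" "S \<ge> Z + (X + X') / 2" "M = W + 2 * Z + Y"
      for M Y B B' C C' W Z
      using that by (simp add: field_simps)
    from this[OF *[OF b] *[OF b'] XX S sq] show ?thesis by (simp only: power2_eq_square)
  qed
  have low: "w * (p - \<sigma> * w) \<le> Y" "w * q \<le> Y"
    if p: "\<sigma> * w \<le> p" "p \<le> w" and q: "0 \<le> q" "q \<le> \<sigma> * w"
      and Y: "Y \<ge> min (peak_bound w \<sigma> b p q) (corner_bound w \<sigma> p q)" for p q Y
  proof -
    have "b * (p - \<sigma> * w) \<ge> 0" using b p by simp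
    hence T: "peak_bound w \<sigma> b p q \<ge> w * ((1 - \<sigma>) * p + \<sigma> * q)" by (simp add: peak_bound_def)
    have "\<sigma> * (w + q - p) \<ge> 0" "(1 - \<sigma>) * (p - q) \<ge> 0" using \<sigma> p q by auto
    hence "(1 - \<sigma>) * p + \<sigma> * q \<ge> p - \<sigma> * w" "(1 - \<sigma>) * p + \<sigma> * q \<ge> q" by (simp_all add: algebra_simps)
    hence "w * ((1 - \<sigma>) * p + \<sigma> * q) \<ge> w * (p - \<sigma> * w)" "w * ((1 - \<sigma>) * p + \<sigma> * q) \<ge> w * q"
      using w by (auto intro: mult_left_mono)
    moreover have "corner_bound w \<sigma> p q \<ge> w * (p - \<sigma> * w)" "corner_bound w \<sigma> p q \<ge> w * q"
      unfolding corner_bound_def using w p q by (auto intro!: mult_left_mono)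
    ultimately show "w * (p - \<sigma> * w) \<le> Y" "w * q \<le> Y" using T Y by linarith+
  qed
  \<comment> \<open>The two \<open>p\<close> guarantee \<open>(1 - \<sigma>) * w - b\<close> above
    the segment level \<open>\<sigma> * w\<close>, the two \<open>q\<close> guarantee
    \<open>\<sigma> * w - b'\<close>. One of the two is at least \<open>w / 2 - a\<close>, according
    to whether \<open>\<sigma> \<le> 1 / 2\<close>.\<close>
  have "w * (w / 2 - a) \<le> X + X'"
  proof (cases "\<sigma> \<le> 1 / 2")
    case True
    have "\<sigma> * w \<le> 1 / 2 * w" using True w by (rule mult_right_mono)
    hence "w / 2 - a \<le> (p - \<sigma> * w) + (p' - \<sigma> * w)" using pp b by (simp add: algebra_simps)
    hence "w * (w / 2 - a) \<le> w * ((p - \<sigma> * w) + (p' - \<sigma> * w))" using w by (rule mult_left_mono)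
    also have "\<dots> \<le> X + X'"
      unfolding distrib_left using low(1)[OF p q X] low(1)[OF p' q' X'] by (rule add_mono)
    finally show ?thesis .
  next
    case False
    have "\<sigma> * w \<ge> 1 / 2 * w" using False w by (intro mult_right_mono) auto
    hence "w / 2 - a \<le> q + q'" using qq b' by (simp add: algebra_simps)
    hence "w * (w / 2 - a) \<le> w * (q + q')" using w by (rule mult_left_mono)
    also have "\<dots> \<le> X + X'"
      unfolding distrib_left using low(2)[OF p q X] low(2)[OF p' q' X'] by (rule add_mono)
    finally show ?thesis .
  qed
  moreover have "(W + 2 * Z + Y) / 2 \<le> 2 * S + Y / 2"
    if "W / 2 - Z \<le> X + X'" "S \<ge> Z + (X + X') / 2" for W Y Z
    using that by (simp add: field_simps)
  ultimately show "2 * S + a\<^sup>2 / 2 \<ge> (w + a)\<^sup>2 / 2"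
    using S unfolding sq unfolding power2_eq_square by (simp add: right_diff_distrib mult.commute)
qed

lemma chain_knots:
  assumes "convex K" "(\<alpha>, y0) \<in> K" "(r, y1) \<in> K" "(s, y2) \<in> K" "(\<beta>, y3) \<in> K" "\<alpha> \<le> r" "r \<le> s" "s \<le> \<beta>"
  shows "chain K \<alpha> \<beta> ((r - \<alpha>) * (y0 + y1) / 2 + (s - r) * (y1 + y2) / 2 + (\<beta> - s) * (y2 + y3) / 2)"
  using chain_join[OF chain_join[OF chain_segment[of K \<alpha> y0 r y1] chain_segment[of K r y1 s y2]]
      chain_segment[of K s y2 \<beta> y3]] assms by blast

text \<open>The body in coordinates where the two parallel sides are vertical, at abscissas 0 and
  \<open>w\<close>. It has horizontal sides of length at least \<open>b\<close> at heights
  \<open>Y1\<close> and \<open>Y0\<close>, and supporting lines of slope 1 given by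
  \<open>Z1\<close> and \<open>Z0\<close>. Its area exceeds that of the parallelogram by the areas
  cut off by an upper and a lower chain.\<close>

lemma planar_bound:
  fixes K :: "(real \<times> real) set"
  assumes K: "compact K" "convex K"
    and w: "0 \<le> w" and a: "0 \<le> a" and \<sigma>: "0 \<le> \<sigma>" "\<sigma> \<le> 1"
    and b: "0 \<le> b" "b \<le> a" and b': "0 \<le> b'" "b' \<le> a"
    and left: "(0, 0) \<in> K" "(0, a) \<in> K" and right: "(w, \<sigma> * w) \<in> K" "(w, \<sigma> * w + a) \<in> K"
    and x: "\<And>z. z \<in> K \<Longrightarrow> 0 \<le> fst z" "\<And>z. z \<in> K \<Longrightarrow> fst z \<le> w"
    and top: "(t, Y1) \<in> K" "(t + b, Y1) \<in> K" "\<And>z. z \<in> K \<Longrightarrow> snd z \<le> Y1"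
    and bot: "(s, Y0) \<in> K" "(s + b, Y0) \<in> K" "\<And>z. z \<in> K \<Longrightarrow> Y0 \<le> snd z"
    and Y: "Y1 - Y0 \<ge> w + a - b"
    and top': "(t', t' + Z1) \<in> K" "\<And>z. z \<in> K \<Longrightarrow> snd z - fst z \<le> Z1"
    and bot': "(s', s' + Z0) \<in> K" "\<And>z. z \<in> K \<Longrightarrow> Z0 \<le> snd z - fst z"
    and Z: "Z1 - Z0 \<ge> w + a - b'"
  shows "area K + (a\<^sup>2 + b\<^sup>2 + b'\<^sup>2) / 2 \<ge> 3 / 8 * (w + a)\<^sup>2"
    and "2 * area K + a\<^sup>2 / 2 \<ge> (w + a)\<^sup>2 / 2"
proof -
  define half where "half p q t t' = t * (q - \<sigma> * w) + t * t' + (w - t') * p" for p q t t'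
  \<comment> \<open>\<open>p\<close>, \<open>q\<close> belong to the upper half moved down by
    \<open>a\<close>, and \<open>p'\<close>, \<open>q'\<close> to the lower half after the point
    reflection of \<open>(x, y)\<close> to \<open>(w - x, \<sigma> * w - y)\<close>. Both halves
    then have the normal form of \<open>half_area_bound\<close>.\<close>
  define p where "p = Y1 - a"
  define q where "q = Z1 - a"
  define p' where "p' = \<sigma> * w - Y0"
  define q' where "q' = (\<sigma> - 1) * w - Z0"
  have t: "0 \<le> t'" "t' \<le> p - q" "p - q + b \<le> t + b" "t + b \<le> w" "\<sigma> * w \<le> p" "0 \<le> q"
    using x(1)[OF top'(1)] top(3)[OF top'(1)] top'(2)[OF top(1)] x(2)[OF top(2)] top(3)[OF right(2)]
      top'(2)[OF left(2)] by (auto simp: p_def q_def)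
  have s: "0 \<le> w - s'" "w - s' \<le> p' - q'" "p' - q' + b \<le> w - s" "w - s \<le> w" "\<sigma> * w \<le> p'" "0 \<le> q'"
    using x(2)[OF bot'(1)] bot(3)[OF bot'(1)] bot'(2)[OF bot(2)] x(1)[OF bot(1)] bot(3)[OF left(1)]
      bot'(2)[OF right(1)] by (auto simp: p'_def q'_def left_diff_distrib)
  have \<sigma>w: "\<sigma> * w \<le> w" "0 \<le> \<sigma> * w" using \<sigma> w by (auto simp: mult_left_le_one_le)
  \<comment> \<open>The knots are \<open>(0, a)\<close>, the contact point with the line of slope 1,
    the right end of the top side, and \<open>(w, \<sigma> * w + a)\<close>.\<close>
  have "chain K 0 w ((t' - 0) * (a + (t' + Z1)) / 2 + ((t + b) - t') * ((t' + Z1) + Y1) / 2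
      + (w - (t + b)) * (Y1 + (\<sigma> * w + a)) / 2)" (is "chain K 0 w ?I")
    using t b by (intro chain_knots K left right top top') auto
  moreover have "?I = a * w + \<sigma> * w * w / 2 + half p q (t + b) t' / 2"
    by (simp add: half_def p_def q_def field_simps)
  \<comment> \<open>The left end of the bottom side is used here; the reflection turns it into the
    right end.\<close>
  moreover have "chain K 0 w ((s - 0) * (0 + Y0) / 2 + (s' - s) * (Y0 + (s' + Z0)) / 2
      + (w - s') * ((s' + Z0) + \<sigma> * w) / 2)" (is "chain K 0 w ?J")
    using s b by (intro chain_knots K left right bot bot') auto
  moreover have "?J = \<sigma> * w * w / 2 - half p' q' (w - s) (w - s') / 2"
    by (simp add: half_def p'_def q'_def field_simps)
  ultimately have S: "area K \<ge> a * w + (half p q (t + b) t' + half p' q' (w - s) (w - s')) / 2"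
    using area_ge_chain_diff[OF K, of 0 w ?I ?J] by (simp add: add_divide_distrib)
  note X = half_area_bound[OF \<sigma> w t(1-6) b(1), folded half_def]
  note X' = half_area_bound[OF \<sigma> w s(1-6) b(1), folded half_def]
  have pp: "p + p' \<ge> (1 + \<sigma>) * w - b" "q + q' \<ge> \<sigma> * w - b'"
    using Y Z by (simp_all add: p_def p'_def q_def q'_def algebra_simps)
  \<comment> \<open>Truncation at \<open>w\<close> and \<open>\<sigma> * w\<close> preserves the
    width inequalities: a truncated summand alone suffices, together with the lower bound of the
    other.\<close>
  have "min p w + min p' w \<ge> (1 + \<sigma>) * w - b" "min q (\<sigma> * w) + min q' (\<sigma> * w) \<ge> \<sigma> * w - b'"
    using pp \<sigma>w t(5,6) s(5,6) b b' by (auto simp: min_def distrib_right)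
  note * = two_halves_bound[OF \<sigma> w a b b' _ _ _ _ _ _ _ _ this X X' S]
  show "area K + (a\<^sup>2 + b\<^sup>2 + b'\<^sup>2) / 2 \<ge> 3 / 8 * (w + a)\<^sup>2"
    using \<sigma>w t(5,6) s(5,6) by (intro *) auto
  show "2 * area K + a\<^sup>2 / 2 \<ge> (w + a)\<^sup>2 / 2"
    using \<sigma>w t(5,6) s(5,6) by (intro *) auto
qed

section \<open>The lifted Newton polygon\<close>

definition lift_exp :: "(int \<times> int \<Rightarrow> real) \<Rightarrow> int \<times> int \<Rightarrow> real \<times> real \<times> real" where
  "lift_exp \<kappa> a = (real_of_int (fst a), real_of_int (snd a), \<kappa> a)"

text \<open>A compact substitute for the extended Newton polyhedron, with the same upper
  boundary.\<close>

definition lifted_polygon :: "(int \<times> int) set \<Rightarrow> (int \<times> int \<Rightarrow> real) \<Rightarrow> (real \<times> real \<times> real) set" where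
  "lifted_polygon A \<kappa> = convex hull (lift_exp \<kappa> ` A)"

definition base :: "real \<times> real \<times> real \<Rightarrow> real \<times> real" where
  "base p = (fst p, fst (snd p))"

definition height :: "real \<times> real \<times> real \<Rightarrow> real" where
  "height p = snd (snd p)"

lemma base_simps [simp]:
  "base (x, y, z) = (x, y)" "base (lift_exp \<kappa> a) = real_vec a"
  "base (p + q) = base p + base q" "base (r *\<^sub>R p) = r *\<^sub>R base p"
  by (simp_all add: base_def lift_exp_def real_vec_def)

lemma height_simps [simp]:
  "height (x, y, z) = z" "height (lift_exp \<kappa> a) = \<kappa> a"
  "height (p + q) = height p + height q" "height (r *\<^sub>R p) = r * height p"
  by (simp_all add: height_def lift_exp_def)

lemma continuous_on_base [continuous_intros]: "continuous_on S base"
  unfolding base_def by (intro continuous_intros)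

lemma continuous_on_height [continuous_intros]: "continuous_on S height"
  unfolding height_def by (intro continuous_intros)

lemma base_height: "p = (fst (base p), snd (base p), height p)"
  by (simp add: base_def height_def)

lemma compact_lifted_polygon: "finite A \<Longrightarrow> compact (lifted_polygon A \<kappa>)"
  unfolding lifted_polygon_def by (intro finite_imp_compact_convex_hull finite_imageI)

lemma convex_lifted_polygon: "convex (lifted_polygon A \<kappa>)"
  by (simp add: lifted_polygon_def)

lemma lift_exp_in: "a \<in> A \<Longrightarrow> lift_exp \<kappa> a \<in> lifted_polygon A \<kappa>"
  by (simp add: lifted_polygon_def hull_inc)

lemma extended_newton_polyhedron_iff:
  "(x, y, \<mu>) \<in> extended_newton_polyhedron A \<kappa> \<longleftrightarrow> (\<exists>z\<ge>\<mu>. (x, y, z) \<in> lifted_polygon A \<kappa>)" (is "?L \<longleftrightarrow> ?R")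
proof -
  define X where "X = {(real_of_int i, real_of_int j, s) | i j s. (i, j) \<in> A \<and> s \<le> \<kappa> (i, j)}"
  \<comment> \<open>\<open>N\<close> consists of the points on or below the lifted polygon.\<close>
  define N where "N = {p. \<exists>q\<in>lifted_polygon A \<kappa>. base q = base p \<and> height q \<ge> height p}"
  have ext: "extended_newton_polyhedron A \<kappa> = convex hull X"
    by (simp add: extended_newton_polyhedron_def X_def)
  have "?R" if L: ?L
  proof -
    have "convex N"
    proof (rule convexI)
      fix p p' and r s :: real
      assume p: "p \<in> N" "p' \<in> N" and r: "0 \<le> r" "0 \<le> s" "r + s = 1"
      then obtain q q' where "q \<in> lifted_polygon A \<kappa>" "base q = base p" "height q \<ge> height p"
        "q' \<in> lifted_polygon A \<kappa>" "base q' = base p'" "height q' \<ge> height p'"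
        unfolding N_def by blast
      thus "r *\<^sub>R p + s *\<^sub>R p' \<in> N"
        using r unfolding N_def
        by (intro CollectI bexI[of _ "r *\<^sub>R q + s *\<^sub>R q'"] conjI)
          (auto intro!: add_mono mult_left_mono convexD[OF convex_lifted_polygon])
    qed
    moreover have "X \<subseteq> N"
    proof
      fix p assume "p \<in> X"
      then obtain i j s where p: "p = (real_of_int i, real_of_int j, s)" "(i, j) \<in> A" "s \<le> \<kappa> (i, j)"
        unfolding X_def by blast
      thus "p \<in> N" unfolding N_def
        by (intro CollectI bexI[of _ "lift_exp \<kappa> (i, j)"]) (auto simp: lift_exp_in real_vec_def)
    qed
    ultimately have "convex hull X \<subseteq> N" by (rule hull_minimal[rotated])
    then obtain q where "q \<in> lifted_polygon A \<kappa>" "base q = (x, y)" "height q \<ge> \<mu>"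
      using L unfolding ext N_def by auto
    thus ?R using base_height[of q] by auto
  qed
  moreover have "?L" if ?R
  proof -
    from that obtain z where z: "z \<ge> \<mu>" "(x, y, z) \<in> lifted_polygon A \<kappa>" by blast
    have "lift_exp \<kappa> ` A \<subseteq> X"
      by (force simp: X_def lift_exp_def)
    hence "(x, y, z) \<in> convex hull X" using z hull_mono unfolding lifted_polygon_def by blast
    \<comment> \<open>A downward translation maps the generating set into itself, hence also its
      hull.\<close>
    hence "(0, 0, \<mu> - z) + (x, y, z) \<in> (\<lambda>p. (0, 0, \<mu> - z) + p) ` (convex hull X)" by blast
    also have "\<dots> = convex hull ((\<lambda>p. (0, 0, \<mu> - z) + p) ` X)"
      by (rule convex_hull_translation[symmetric])
    also have "\<dots> \<subseteq> convex hull X"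
      using z(1) by (intro hull_mono) (force simp: X_def)
    finally show ?L by (simp add: ext)
  qed
  ultimately show ?thesis by blast
qed

lemma polyhedron_section_eq:
  "polyhedron_section A \<kappa> \<mu> = base ` {p \<in> lifted_polygon A \<kappa>. height p \<ge> \<mu>}"
proof -
  have "(x, y) \<in> polyhedron_section A \<kappa> \<mu> \<longleftrightarrow> (x, y) \<in> base ` {p \<in> lifted_polygon A \<kappa>. height p \<ge> \<mu>}" for x y
    unfolding polyhedron_section_def extended_newton_polyhedron_iff
    by (force simp: base_def height_def)
  thus ?thesis by auto
qed

lemma compact_polyhedron_section: "finite A \<Longrightarrow> compact (polyhedron_section A \<kappa> \<mu>)"
proof -
  assume "finite A"
  have "closed {p. height p \<ge> \<mu>}"
    by (intro closed_Collect_le continuous_intros)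
  hence "compact (lifted_polygon A \<kappa> \<inter> {p. height p \<ge> \<mu>})"
    using \<open>finite A\<close> by (intro compact_Int_closed compact_lifted_polygon)
  hence "compact (base ` (lifted_polygon A \<kappa> \<inter> {p. height p \<ge> \<mu>}))"
    by (intro compact_continuous_image continuous_intros)
  thus ?thesis by (simp add: polyhedron_section_eq Int_def)
qed

lemma convex_polyhedron_section: "convex (polyhedron_section A \<kappa> \<mu>)"
proof (rule convexI)
  fix x x' and r s :: real
  assume "x \<in> polyhedron_section A \<kappa> \<mu>" "x' \<in> polyhedron_section A \<kappa> \<mu>" and r: "0 \<le> r" "0 \<le> s" "r + s = 1"
  then obtain p p' where p: "p \<in> lifted_polygon A \<kappa>" "\<mu> \<le> height p" "x = base p"
     "p' \<in> lifted_polygon A \<kappa>" "\<mu> \<le> height p'" "x' = base p'"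
    unfolding polyhedron_section_eq by blast
  have "\<mu> = r * \<mu> + s * \<mu>" using r(3) by (simp flip: distrib_right)
  also have "\<dots> \<le> r * height p + s * height p'" using p r by (intro add_mono mult_left_mono)
  finally have "r *\<^sub>R p + s *\<^sub>R p' \<in> {p \<in> lifted_polygon A \<kappa>. height p \<ge> \<mu>}"
    using p r by (auto intro!: convexD[OF convex_lifted_polygon])
  thus "r *\<^sub>R x + s *\<^sub>R x' \<in> polyhedron_section A \<kappa> \<mu>"
    unfolding polyhedron_section_eq using p by (auto intro!: image_eqI[of _ _ "r *\<^sub>R p + s *\<^sub>R p'"])
qed

section \<open>Supporting planes of the lifted polygon and dual faces\<close>

lemma trop_monomial_shift:
  "trop_monomial c Q a = trop_monomial c P a + real_vec a \<bullet> (Q - P)"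
  by (simp add: trop_monomial_def real_vec_def inner_prod_def algebra_simps)

lemma trop_monomial_le: "finite A \<Longrightarrow> a \<in> A \<Longrightarrow> trop_monomial c Q a \<le> trop_poly A c Q"
  unfolding trop_poly_def by (intro Max_ge) auto

text \<open>At a lifted exponent the affine function on the left is the value of the monomial at
  \<open>Q\<close>. Both claims hold at the exponents and pass to the hull: a proper convex
  combination reaches the maximum only if both of its ends do.\<close>

lemma lifted_polygon_supporting:
  assumes "finite A" and p: "p \<in> lifted_polygon A (trop_monomial c P)"
  shows "height p + base p \<bullet> (Q - P) \<le> trop_poly A c Q"
    and "height p + base p \<bullet> (Q - P) = trop_poly A c Q \<Longrightarrow> base p \<in> dual_face A c Q"
proof -
  define g where "g p = height p + base p \<bullet> (Q - P)" for p
  define F where "F = trop_poly A c Q"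
  define N where "N = {p. g p \<le> F \<and> (g p = F \<longrightarrow> base p \<in> dual_face A c Q)}"
  have g_lin: "g (r *\<^sub>R p + s *\<^sub>R q) = r * g p + s * g q" for r s p q
    by (simp add: g_def inner_left_distrib algebra_simps)
  have "convex N"
  proof (rule convexI)
    fix p q and r s :: real
    assume pq: "p \<in> N" "q \<in> N" and r: "0 \<le> r" "0 \<le> s" "r + s = 1"
    have 1: "r * g p \<le> r * F" "s * g q \<le> s * F" using pq r by (auto simp: N_def intro: mult_left_mono)
    have 2: "r * F + s * F = F" using r(3) by (simp flip: distrib_right)
    have "base (r *\<^sub>R p + s *\<^sub>R q) \<in> dual_face A c Q" if "r * g p + s * g q = F"
    proof -
      have "r * g p = r * F" "s * g q = s * F" using 1 2 that by linarith+
      hence *: "r = 0 \<or> base p \<in> dual_face A c Q" "s = 0 \<or> base q \<in> dual_face A c Q"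
        using pq by (auto simp: N_def)
      consider "r = 0" | "s = 0" | "r \<noteq> 0" "s \<noteq> 0" by blast
      thus ?thesis
      proof cases
        case 3
        thus ?thesis using * r by (auto simp: dual_face_def intro!: convexD)
      qed (use * r in auto)
    qed
    thus "r *\<^sub>R p + s *\<^sub>R q \<in> N"
      using add_mono[OF 1] unfolding N_def mem_Collect_eq g_lin 2 by blast
  qed
  moreover have "lift_exp (trop_monomial c P) ` A \<subseteq> N"
  proof (rule image_subsetI)
    fix a assume a: "a \<in> A"
    have *: "g (lift_exp (trop_monomial c P) a) = trop_monomial c Q a"
      by (simp add: g_def trop_monomial_shift[of c Q _ P])
    have "real_vec a \<in> dual_face A c Q" if "trop_monomial c Q a = F"
      using that a unfolding dual_face_def by (intro hull_inc) (auto simp: maximal_exponents_def F_def)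
    thus "lift_exp (trop_monomial c P) a \<in> N"
      unfolding N_def using trop_monomial_le[OF assms(1) a, of c Q] by (auto simp: * F_def)
  qed
  ultimately have "lifted_polygon A (trop_monomial c P) \<subseteq> N"
    unfolding lifted_polygon_def by (rule hull_minimal[rotated])
  thus "height p + base p \<bullet> (Q - P) \<le> trop_poly A c Q"
    and "height p + base p \<bullet> (Q - P) = trop_poly A c Q \<Longrightarrow> base p \<in> dual_face A c Q"
    using p by (auto simp: N_def g_def F_def)
qed

text \<open>Over \<open>d(Q)\<close> the upper boundary is the supporting plane belonging to
  \<open>Q\<close>; the affine map \<open>e\<close> into that plane sends the maximal exponents to
  their lifts.\<close>

lemma dual_face_lift:
  assumes "x \<in> dual_face A c Q"
  obtains p where "p \<in> lifted_polygon A (trop_monomial c P)" "base p = x"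
    "height p = trop_poly A c Q - x \<bullet> (Q - P)"
proof -
  define e where "e x = (fst x, snd x, trop_poly A c Q - x \<bullet> (Q - P))" for x
  have "dual_face A c Q \<subseteq> {x. e x \<in> lifted_polygon A (trop_monomial c P)}"
    unfolding dual_face_def
  proof (rule hull_minimal)
    show "real_vec ` maximal_exponents A c Q \<subseteq> {x. e x \<in> lifted_polygon A (trop_monomial c P)}"
    proof (rule image_subsetI, rule CollectI)
      fix a assume a: "a \<in> maximal_exponents A c Q"
      hence "trop_poly A c Q = trop_monomial c P a + real_vec a \<bullet> (Q - P)"
        using trop_monomial_shift[of c Q a P] by (simp add: maximal_exponents_def)
      hence "e (real_vec a) = lift_exp (trop_monomial c P) a"
        by (simp add: e_def lift_exp_def) (simp add: real_vec_def)
      thus "e (real_vec a) \<in> lifted_polygon A (trop_monomial c P)"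
        using a by (simp add: lift_exp_in maximal_exponents_def)
    qed
    show "convex {x. e x \<in> lifted_polygon A (trop_monomial c P)}"
    proof (rule convexI, rule CollectI)
      fix x y and r s :: real
      assume xy: "x \<in> {x. e x \<in> lifted_polygon A (trop_monomial c P)}"
        "y \<in> {x. e x \<in> lifted_polygon A (trop_monomial c P)}" and r: "0 \<le> r" "0 \<le> s" "r + s = 1"
      have s: "s = 1 - r" using r by simp
      have "e (r *\<^sub>R x + s *\<^sub>R y) = r *\<^sub>R e x + s *\<^sub>R e y"
        unfolding s by (simp add: e_def inner_left_distrib algebra_simps)
      thus "e (r *\<^sub>R x + s *\<^sub>R y) \<in> lifted_polygon A (trop_monomial c P)"
        using xy r by (simp add: convexD[OF convex_lifted_polygon])
    qed
  qed
  thus ?thesis using that[of "e x"] assms by (auto simp: e_def)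
qed

section \<open>Long edges at a vertex of given multiplicity\<close>

lemma primitive_nz: "primitive u \<Longrightarrow> real_vec u \<noteq> 0" "primitive u \<Longrightarrow> real_vec (perp u) \<noteq> 0"
  by (auto simp: primitive_def real_vec_def perp_def zero_prod_def)

lemma inner_perp: "real_vec u \<bullet> real_vec (perp u) = 0"
  by (simp add: real_vec_def perp_def)

text \<open>A supporting functional at the midpoint of two points of the side is minimal at that
  midpoint, hence equal at both points, hence a multiple of \<open>u\<close>.\<close>

lemma edge_supporting:
  assumes C: "convex C" "aff_dim C = 2" and u: "primitive u"
    and F: "F edge_of C" "parallel_to (perp u) F"
  obtains k where "F = {x \<in> C. real_vec u \<bullet> x = k}"
    "(\<forall>x\<in>C. real_vec u \<bullet> x \<le> k) \<or> (\<forall>x\<in>C. k \<le> real_vec u \<bullet> x)"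
proof -
  from F have F1: "F face_of C" "aff_dim F = 1" by (auto simp: edge_of_def)
  hence FC: "F \<subseteq> C" "convex F" "F \<noteq> C" using face_of_imp_subset face_of_imp_convex C by auto
  have "\<not> (\<exists>p. F \<subseteq> {p})"
  proof
    assume "\<exists>p. F \<subseteq> {p}"
    then obtain p where "F \<subseteq> {p}" by blast
    hence "aff_dim F \<le> aff_dim {p}" by (rule aff_dim_subset)
    thus False using F1 by simp
  qed
  then obtain p q where pq: "p \<in> F" "q \<in> F" "p \<noteq> q" by blast
  define z where "z = midpoint p q"
  have z: "z \<in> F"
    using closed_segment_subset[OF pq(1,2) FC(2)] midpoint_in_closed_segment[of p q]
    unfolding z_def by blast
  have zC: "z \<in> C" "z \<notin> rel_interior C"
    using face_of_disjoint_rel_interior[OF F1(1) FC(3)] z FC(1) by blast+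
  obtain a where a: "a \<noteq> 0" "\<And>y. y \<in> C \<Longrightarrow> a \<bullet> z \<le> a \<bullet> y"
    using supporting_hyperplane_rel_boundary[OF C(1) zC] by metis
  have a2: "\<forall>y\<in>C. a \<bullet> z \<le> a \<bullet> y" using a(2) by blast
  have "a \<bullet> z \<le> a \<bullet> p" "a \<bullet> z \<le> a \<bullet> q" using a2 pq FC(1) by blast+
  moreover have "a \<bullet> z = (a \<bullet> p + a \<bullet> q) / 2" by (simp add: z_def midpoint_def inner_add_right)
  ultimately have 0: "a \<bullet> (p - q) = 0" by (simp add: inner_diff_right)
  obtain t where t: "p - q = t *\<^sub>R real_vec (perp u)" using F(2) pq unfolding parallel_to_def by blast
  have "t \<noteq> 0" using t pq by auto
  hence ap: "a \<bullet> real_vec (perp u) = 0" using 0 t by simp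
  define U where "U = real_vec u"
  define l where "l = (a \<bullet> U) / (U \<bullet> U)"
  have U: "U \<bullet> U \<noteq> 0" using primitive_nz(1)[OF u] by (simp add: U_def)
  have al: "a = l *\<^sub>R U"
  proof -
    obtain a1 a2 where a12: "a = (a1, a2)" by (cases a)
    obtain u1 u2 where u12: "U = (u1, u2)" by (cases U)
    have "a2 * u1 = a1 * u2" using ap u12 by (simp add: a12 real_vec_def perp_def U_def)
    hence "(U \<bullet> U) *\<^sub>R a = (a \<bullet> U) *\<^sub>R U"
      unfolding a12 u12 by (simp add: algebra_simps)
    thus ?thesis using U by (simp add: l_def field_simps eq_vector_fraction_iff)
  qed
  hence l: "l \<noteq> 0" using a(1) by auto
  define k where "k = U \<bullet> z"
  have sup: "(\<forall>x\<in>C. U \<bullet> x \<le> k) \<or> (\<forall>x\<in>C. k \<le> U \<bullet> x)"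
  proof (cases "l > 0")
    case True
    thus ?thesis using a2 by (simp add: al k_def)
  next
    case False
    hence "l < 0" using l by simp
    thus ?thesis using a2 by (simp add: al k_def mult_le_cancel_left)
  qed
  define G where "G = C \<inter> {x. U \<bullet> x = k}"
  have "G face_of C"
    using sup face_of_Int_supporting_hyperplane_le[OF C(1), where a = U and b = k]
      face_of_Int_supporting_hyperplane_ge[OF C(1), where a = U and b = k] unfolding G_def by blast
  have FG: "F \<subseteq> G"
  proof
    fix x assume x: "x \<in> F"
    then obtain t where "x - z = t *\<^sub>R real_vec (perp u)" using F(2) z unfolding parallel_to_def by blast
    hence "U \<bullet> (x - z) = 0" by (simp add: U_def inner_perp)
    thus "x \<in> G" using x FC(1) by (auto simp: G_def k_def inner_diff_right)
  qed
  \<comment> \<open>The face \<open>G\<close> cut out by the supporting line has dimension at most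
    1, so a one-dimensional face of it is all of \<open>G\<close>.\<close>
  have "F face_of G" using face_of_subset[OF F1(1) FG] by (auto simp: G_def)
  moreover have "aff_dim G \<le> 1"
  proof -
    have "aff_dim G \<le> aff_dim {x. U \<bullet> x = k}" by (rule aff_dim_subset) (auto simp: G_def)
    also have "\<dots> = 1" using primitive_nz(1)[OF u] by (simp add: U_def)
    finally show ?thesis .
  qed
  moreover have "convex G" unfolding G_def by (intro convex_Int C convex_hyperplane)
  ultimately have "F = G" using face_of_aff_dim_lt[of G F] F1(2) by force
  thus ?thesis using that[of k] sup by (auto simp: G_def U_def)
qed

text \<open>Thickness yields two different sides perpendicular to \<open>u\<close>, hence one at
  each extreme value of \<open>u\<close>. The side at the maximum has lattice length at least the
  defect of \<open>C\<close>, which is at least \<open>y\<close>, and compactness supplies its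
  ends.\<close>

lemma thick_edge_points:
  assumes thick: "thick m C" and C: "compact C" "convex C" "aff_dim C = 2" and u: "primitive u" and y: "y > 0"
    and width: "\<And>x x'. x \<in> C \<Longrightarrow> x' \<in> C \<Longrightarrow> real_vec u \<bullet> (x - x') \<le> real m - y"
    and h: "\<And>x. x \<in> C \<Longrightarrow> real_vec u \<bullet> x \<le> h" and x0: "x0 \<in> C" "real_vec u \<bullet> x0 = h"
  obtains x x' \<tau> where "x \<in> C" "x' \<in> C" "real_vec u \<bullet> x = h" "real_vec u \<bullet> x' = h"
    "x - x' = \<tau> *\<^sub>R real_vec (perp u)" "\<bar>\<tau>\<bar> \<ge> y"
proof -
  have hull: "convex hull C = C" using C(2) by (rule convex_hull_eq[THEN iffD2])
  define a where "a = real m - lattice_width u C"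
  have "lattice_width u C \<le> real m - y"
    unfolding lattice_width_def using x0(1) width by (intro cSUP_least) auto
  hence a: "a \<ge> y" "a > 0" using y by (auto simp: a_def)
  have "C \<noteq> {}" using x0 by auto
  hence "\<forall>u a. primitive u \<and> a > 0 \<and> lattice_width u C = real m - a \<longrightarrow>
         (\<exists>S T. S \<noteq> T \<and> S edge_of C \<and> parallel_to (perp u) S \<and> lattice_length (perp u) S \<ge> a \<and>
            T edge_of C \<and> parallel_to (perp u) T \<and> lattice_length (perp u) T \<ge> a)"
    using thick C(3) unfolding thick_def hull by simp
  from this[rule_format, of u a] have "\<exists>S T. S \<noteq> T \<and> S edge_of C \<and> parallel_to (perp u) S \<and> lattice_length (perp u) S \<ge> a \<and>
            T edge_of C \<and> parallel_to (perp u) T \<and> lattice_length (perp u) T \<ge> a"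
    using a(2) u by (simp add: a_def)
  then obtain S T where ST: "S \<noteq> T" "S edge_of C" "parallel_to (perp u) S" "lattice_length (perp u) S \<ge> a"
     "T edge_of C" "parallel_to (perp u) T" "lattice_length (perp u) T \<ge> a" by blast
  obtain k where k: "S = {x \<in> C. real_vec u \<bullet> x = k}"
    "(\<forall>x\<in>C. real_vec u \<bullet> x \<le> k) \<or> (\<forall>x\<in>C. k \<le> real_vec u \<bullet> x)"
    using edge_supporting[OF C(2,3) u ST(2,3)] .
  obtain l where l: "T = {x \<in> C. real_vec u \<bullet> x = l}"
    "(\<forall>x\<in>C. real_vec u \<bullet> x \<le> l) \<or> (\<forall>x\<in>C. l \<le> real_vec u \<bullet> x)"
    using edge_supporting[OF C(2,3) u ST(5,6)] .
  have ne: "S \<noteq> {}" "T \<noteq> {}" using ST(2,5) by (auto simp: edge_of_def)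
  then obtain s t where s: "s \<in> C" "real_vec u \<bullet> s = k" and t: "t \<in> C" "real_vec u \<bullet> t = l"
    using k(1) l(1) by blast
  have "k \<noteq> l" using ST(1) k(1) l(1) by auto
  hence "k = h \<or> l = h"
    using k(2) l(2) s t h[OF s(1)] h[OF t(1)] x0 by (metis order_antisym)
  then obtain F where F: "F = {x \<in> C. real_vec u \<bullet> x = h}" "parallel_to (perp u) F" "lattice_length (perp u) F \<ge> a"
    using k(1) l(1) ST by blast
  have "F = C \<inter> {x. real_vec u \<bullet> x = h}" using F(1) by blast
  hence "compact F" "F \<noteq> {}" using C(1) x0 by (auto simp: compact_Int_closed closed_hyperplane)
  then obtain x x' where x: "x \<in> F" "x' \<in> F" "dist x x' = diameter F"
    using diameter_compact_attained by blast
  obtain \<tau> where \<tau>: "x - x' = \<tau> *\<^sub>R real_vec (perp u)" using F(2) x unfolding parallel_to_def by blast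
  have n: "norm (real_vec (perp u)) > 0" using primitive_nz(2)[OF u] by simp
  have "diameter F = \<bar>\<tau>\<bar> * norm (real_vec (perp u))" using x(3) \<tau> by (simp add: dist_norm)
  hence "\<bar>\<tau>\<bar> \<ge> a" using F(3) n by (simp add: lattice_length_def)
  thus ?thesis using that[of x x' \<tau>] x F(1) \<tau> a by auto
qed

section \<open>Maximal exponents along a line through the vertex\<close>

lemma finite_maximal_exponents: "finite A \<Longrightarrow> finite (maximal_exponents A c Q)"
  by (simp add: maximal_exponents_def)

lemma maximal_exponentsI:
  assumes "finite A" "a \<in> A" "\<And>e. e \<in> A \<Longrightarrow> trop_monomial c Q e \<le> trop_monomial c Q a"
  shows "a \<in> maximal_exponents A c Q"
proof -
  have "trop_poly A c Q = trop_monomial c Q a"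
    unfolding trop_poly_def using assms by (intro Max_eqI) auto
  thus ?thesis using assms by (simp add: maximal_exponents_def)
qed

lemma maximal_exponents_nonempty:
  assumes "finite A" "A \<noteq> {}" shows "maximal_exponents A c Q \<noteq> {}"
proof -
  have "trop_poly A c Q \<in> trop_monomial c Q ` A" unfolding trop_poly_def using assms by (intro Max_in) auto
  then obtain a where "a \<in> A" "trop_poly A c Q = trop_monomial c Q a" by blast
  hence "a \<in> maximal_exponents A c Q" by (simp add: maximal_exponents_def)
  thus ?thesis by blast
qed

lemma real_vec_in_dual_face: "a \<in> maximal_exponents A c Q \<Longrightarrow> real_vec a \<in> dual_face A c Q"
  by (simp add: dual_face_def hull_inc)

lemma convex_dual_face: "convex (dual_face A c Q)"
  by (simp add: dual_face_def)

lemma compact_dual_face: "finite A \<Longrightarrow> compact (dual_face A c Q)"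
  unfolding dual_face_def by (intro finite_imp_compact_convex_hull finite_imageI finite_maximal_exponents)

lemma trop_curve_two_points:
  assumes "finite A" "x \<in> dual_face A c Q" "x' \<in> dual_face A c Q" "x \<noteq> x'"
  shows "Q \<in> trop_curve A c"
proof (rule ccontr)
  assume "Q \<notin> trop_curve A c"
  hence "card (maximal_exponents A c Q) \<le> Suc 0" by (simp add: trop_curve_def)
  hence "\<forall>a\<in>maximal_exponents A c Q. \<forall>b\<in>maximal_exponents A c Q. a = b"
    using card_le_Suc0_iff_eq[OF finite_maximal_exponents[OF assms(1)]] by blast
  moreover have "maximal_exponents A c Q \<noteq> {}" using assms(2) by (auto simp: dual_face_def)
  ultimately obtain e where "maximal_exponents A c Q \<subseteq> {e}" by blast
  hence "dual_face A c Q \<subseteq> {real_vec e}" unfolding dual_face_def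
    by (intro hull_minimal) auto
  thus False using assms by blast
qed

lemma aff_dim_plane_le_2: "aff_dim (S :: (real \<times> real) set) \<le> 2"
  using aff_dim_le_DIM[of S] by simp

lemma aff_dim_eq_2I:
  fixes S :: "(real \<times> real) set"
  assumes "x \<in> S" "x' \<in> S" "a \<in> S" "x \<noteq> x'" "U \<bullet> x = h" "U \<bullet> x' = h" "U \<bullet> a \<noteq> h"
  shows "aff_dim S = 2"
proof -
  have "\<not> collinear S"
  proof
    assume "collinear S"
    then obtain v where v: "\<forall>x\<in>S. \<forall>y\<in>S. \<exists>c. x - y = c *\<^sub>R v" unfolding collinear_def by blast
    then obtain r s where r: "x - x' = r *\<^sub>R v" and s: "x - a = s *\<^sub>R v" using assms by metis
    have "r \<noteq> 0" using r assms by auto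
    have "U \<bullet> (x - x') = 0" using assms by (simp add: inner_diff_right)
    hence "U \<bullet> v = 0" using r \<open>r \<noteq> 0\<close> by simp
    hence "U \<bullet> (x - a) = 0" using s by simp
    thus False using assms by (simp add: inner_diff_right)
  qed
  thus ?thesis using aff_dim_plane_le_2[of S] by (simp add: collinear_aff_dim)
qed

text \<open>The edge of the upper hull over \<open>h\<close> is spanned by the pair of exponents whose chord is
  highest over \<open>h\<close>.\<close>

lemma upper_chord:
  assumes fin: "finite A" and ab0: "a0 \<in> A" "b0 \<in> A" "real_vec u \<bullet> real_vec a0 < h" "h < real_vec u \<bullet> real_vec b0"
    and gen: "\<And>e. e \<in> A \<Longrightarrow> real_vec u \<bullet> real_vec e \<noteq> h"
  obtains t a b where "a \<in> maximal_exponents A c (P + t *\<^sub>R real_vec u)"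
    "b \<in> maximal_exponents A c (P + t *\<^sub>R real_vec u)"
    "real_vec u \<bullet> real_vec a < h" "h < real_vec u \<bullet> real_vec b"
proof -
  define L where "L e = real_vec u \<bullet> real_vec e" for e
  define \<kappa> where "\<kappa> = trop_monomial c P"
  define PS where "PS = {(a, b) \<in> A \<times> A. L a < h \<and> h < L b}"
  \<comment> \<open>The height over \<open>h\<close> of the chord joining the lifts of the
    pair.\<close>
  define val where "val p = (\<kappa> (fst p) * (L (snd p) - h) + \<kappa> (snd p) * (h - L (fst p))) / (L (snd p) - L (fst p))" for p
  have "finite PS" unfolding PS_def using fin by (auto intro: finite_subset[of _ "A \<times> A"])
  moreover have "(a0, b0) \<in> PS" using ab0 by (auto simp: PS_def L_def)
  ultimately have "Max (val ` PS) \<in> val ` PS" "\<And>p. p \<in> PS \<Longrightarrow> val p \<le> Max (val ` PS)"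
    by (auto intro!: Max_in)
  then obtain a b where ab: "(a, b) \<in> PS" "\<And>p. p \<in> PS \<Longrightarrow> val p \<le> val (a, b)" by (metis imageE surj_pair)
  hence abA: "a \<in> A" "b \<in> A" "L a < h" "h < L b" by (auto simp: PS_def)
  \<comment> \<open>The negative slope of the highest chord: at
    \<open>P + t *\<^sub>R real_vec u\<close> the monomials \<open>a\<close> and \<open>b\<close>
    agree.\<close>
  define t where "t = - (\<kappa> b - \<kappa> a) / (L b - L a)"
  define v where "v = \<kappa> a + t * L a"
  have "t * (L b - L a) = \<kappa> a - \<kappa> b" using abA by (simp add: t_def)
  hence \<kappa>: "\<kappa> a = v - t * L a" "\<kappa> b = v - t * L b" by (auto simp: v_def algebra_simps)
  have valab: "val (a, b) = v - t * h"
    using abA by (simp add: val_def \<kappa> divide_simps) (simp add: algebra_simps)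
  \<comment> \<open>A lift above the line of the chord would yield a higher chord when paired with
    \<open>a\<close> or \<open>b\<close>, whichever lies across \<open>h\<close>.\<close>
  have le: "\<kappa> e + t * L e \<le> v" if e: "e \<in> A" for e
  proof (cases "L e < h")
    case True
    hence "(e, b) \<in> PS" using e abA by (auto simp: PS_def)
    hence "\<kappa> e * (L b - h) + \<kappa> b * (h - L e) \<le> (v - t * h) * (L b - L e)"
      using ab(2)[of "(e, b)"] abA True unfolding valab by (simp add: val_def divide_le_eq)
    hence "(\<kappa> e + t * L e) * (L b - h) \<le> v * (L b - h)" unfolding \<kappa> by (simp add: algebra_simps)
    thus ?thesis using abA by simp
  next
    case False
    hence h: "h < L e" using gen[OF e] by (simp add: L_def)
    hence "(a, e) \<in> PS" using e abA by (auto simp: PS_def)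
    hence "\<kappa> a * (L e - h) + \<kappa> e * (h - L a) \<le> (v - t * h) * (L e - L a)"
      using ab(2)[of "(a, e)"] abA h unfolding valab by (simp add: val_def divide_le_eq)
    hence "(\<kappa> e + t * L e) * (h - L a) \<le> v * (h - L a)" unfolding \<kappa> by (simp add: algebra_simps)
    thus ?thesis using abA by simp
  qed
  have mon: "trop_monomial c (P + t *\<^sub>R real_vec u) e = \<kappa> e + t * L e" for e
    by (simp add: trop_monomial_shift[of c "P + t *\<^sub>R real_vec u" e P] \<kappa>_def L_def inner_commute)
  have le': "\<kappa> e + t * L e \<le> \<kappa> a + t * L a" "\<kappa> e + t * L e \<le> \<kappa> b + t * L b" if "e \<in> A" for e
    using le[OF that] unfolding \<kappa> by simp_all
  have "a \<in> maximal_exponents A c (P + t *\<^sub>R real_vec u)" "b \<in> maximal_exponents A c (P + t *\<^sub>R real_vec u)"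
    using fin abA le' unfolding mon[symmetric] by (blast intro: maximal_exponentsI)+
  thus ?thesis using that[of a t b] abA by (simp add: L_def)
qed

section \<open>Dual faces met along a ray from the vertex\<close>

locale thick_vertex =
  fixes A :: "(int \<times> int) set" and c :: "int \<times> int \<Rightarrow> real" and P :: "real \<times> real" and m :: nat
  assumes fin: "finite A" and mult: "trop_mult_ge A c P m" and vertex: "P \<in> trop_vertices A c"
begin

abbreviation "LP \<equiv> lifted_polygon A (trop_monomial c P)"

lemma height_le: "p \<in> LP \<Longrightarrow> height p \<le> trop_poly A c P"
  using lifted_polygon_supporting(1)[OF fin, of p c P P] by simp

lemma base_top: "p \<in> LP \<Longrightarrow> height p = trop_poly A c P \<Longrightarrow> base p \<in> dual_face A c P"
  using lifted_polygon_supporting(2)[OF fin, of p c P P] by simp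

lemma top_lift:
  assumes "x \<in> dual_face A c P"
  obtains p where "p \<in> LP" "base p = x" "height p = trop_poly A c P"
  using dual_face_lift[OF assms, of P] by auto

lemma dual_face_subset_section:
  assumes "\<mu> \<le> trop_poly A c P"
  shows "dual_face A c P \<subseteq> polyhedron_section A (trop_monomial c P) \<mu>"
proof
  fix x assume "x \<in> dual_face A c P"
  then obtain p where "p \<in> LP" "base p = x" "height p = trop_poly A c P" by (rule top_lift)
  thus "x \<in> polyhedron_section A (trop_monomial c P) \<mu>" unfolding polyhedron_section_eq using assms by force
qed

lemma section_top: "polyhedron_section A (trop_monomial c P) (trop_poly A c P) = dual_face A c P"
proof
  show "polyhedron_section A (trop_monomial c P) (trop_poly A c P) \<subseteq> dual_face A c P"
    unfolding polyhedron_section_eq using height_le base_top by force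
qed (rule dual_face_subset_section, simp)

lemma aff_dim_section:
  assumes "\<mu> \<le> trop_poly A c P"
  shows "aff_dim (polyhedron_section A (trop_monomial c P) \<mu>) = 2"
  using aff_dim_subset[OF dual_face_subset_section[OF assms]] vertex
    aff_dim_plane_le_2[of "polyhedron_section A (trop_monomial c P) \<mu>"]
  by (simp add: trop_vertices_def)

text \<open>The supporting plane of \<open>Q\<close> falls strictly in direction \<open>u\<close>,
  since \<open>t > 0\<close>. So the section at the height \<open>\<mu>\<close> of the lift of
  \<open>x0\<close> has its maximum of \<open>u\<close> at \<open>x0\<close>, and all its points
  attaining it lie in \<open>d(Q)\<close>. Thickness of this section then gives the two
  points.\<close>

lemma face_points:
  assumes u: "primitive u" and t: "t > 0" and y: "y > 0"
    and Q: "Q = P + t *\<^sub>R real_vec u" and x0: "x0 \<in> dual_face A c Q"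
    and \<mu>: "\<mu> = trop_poly A c Q - t * (real_vec u \<bullet> x0)"
    and width: "\<And>p p'. p \<in> LP \<Longrightarrow> p' \<in> LP \<Longrightarrow> \<mu> \<le> height p \<Longrightarrow> \<mu> \<le> height p' \<Longrightarrow>
      real_vec u \<bullet> (base p - base p') \<le> real m - y"
  obtains x x' \<tau> where "x \<in> dual_face A c Q" "x' \<in> dual_face A c Q"
    "real_vec u \<bullet> x = real_vec u \<bullet> x0" "real_vec u \<bullet> x' = real_vec u \<bullet> x0"
    "x - x' = \<tau> *\<^sub>R real_vec (perp u)" "\<bar>\<tau>\<bar> \<ge> y"
proof -
  define h where "h = real_vec u \<bullet> x0"
  define C where "C = polyhedron_section A (trop_monomial c P) \<mu>"
  obtain p0 where p0: "p0 \<in> LP" "base p0 = x0" "height p0 = trop_poly A c Q - x0 \<bullet> (Q - P)"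
    using dual_face_lift[OF x0] .
  have p0\<mu>: "height p0 = \<mu>" by (simp add: p0(3) \<mu> Q inner_commute)
  hence "\<mu> \<le> trop_poly A c P" using height_le[OF p0(1)] by simp
  hence dim: "aff_dim C = 2" unfolding C_def by (rule aff_dim_section)
  have x0C: "x0 \<in> C" unfolding C_def polyhedron_section_eq using p0 p0\<mu> by force
  have CD: "\<exists>p\<in>LP. base p = x \<and> \<mu> \<le> height p" if "x \<in> C" for x
    using that unfolding C_def polyhedron_section_eq by blast
  have sup: "height p + t * (real_vec u \<bullet> base p) \<le> \<mu> + t * h" if "p \<in> LP" for p
    using lifted_polygon_supporting(1)[OF fin that, of Q] by (simp add: Q \<mu> h_def inner_commute)
  have max: "real_vec u \<bullet> x \<le> h" if x: "x \<in> C" for x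
  proof -
    obtain p where p: "p \<in> LP" "base p = x" "\<mu> \<le> height p" using CD[OF x] by blast
    hence "t * (real_vec u \<bullet> x) \<le> t * h" using sup[OF p(1)] by simp
    thus ?thesis using t by simp
  qed
  have face: "x \<in> dual_face A c Q" if x: "x \<in> C" "real_vec u \<bullet> x = h" for x
  proof -
    obtain p where p: "p \<in> LP" "base p = x" "\<mu> \<le> height p" using CD[OF x(1)] by blast
    have "height p = \<mu>" using sup[OF p(1)] p x(2) by simp
    hence "height p + base p \<bullet> (Q - P) = trop_poly A c Q"
      using p(2) x(2) by (simp add: Q \<mu> h_def inner_commute)
    thus ?thesis using lifted_polygon_supporting(2)[OF fin p(1), of Q] p(2) by simp
  qed
  have w: "real_vec u \<bullet> (x - x') \<le> real m - y" if "x \<in> C" "x' \<in> C" for x x'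
    using CD[OF that(1)] CD[OF that(2)] width by blast
  obtain x x' \<tau> where "x \<in> C" "x' \<in> C" "real_vec u \<bullet> x = h" "real_vec u \<bullet> x' = h"
    "x - x' = \<tau> *\<^sub>R real_vec (perp u)" "\<bar>\<tau>\<bar> \<ge> y"
  proof (rule thick_edge_points[of m C u y h x0])
    show "thick m C" using mult by (simp add: C_def trop_mult_ge_def)
  qed (use dim u y w max x0C in \<open>auto simp: C_def h_def compact_polyhedron_section fin convex_polyhedron_section\<close>)
  thus ?thesis using that[of x x' \<tau>] face by (auto simp: h_def)
qed

text \<open>The vertex is \<open>Q = P + t *\<^sub>R real_vec u\<close>, where \<open>t\<close>
  belongs to the upper chord over \<open>h\<close>. To be shown are \<open>t > 0\<close>, that
  \<open>d(Q)\<close> is 2-dimensional, and that the whole segment from \<open>P\<close> to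
  \<open>Q\<close> lies on the curve.\<close>

lemma influenced_vertex:
  assumes u: "primitive u" and y: "y > 0" and gen: "\<And>e. e \<in> A \<Longrightarrow> real_vec u \<bullet> real_vec e \<noteq> h"
    and r0: "\<And>e. e \<in> maximal_exponents A c P \<Longrightarrow> real_vec u \<bullet> real_vec e < h"
    and p0: "p0 \<in> LP" "real_vec u \<bullet> base p0 = h" "height p0 > \<mu>"
    and width: "\<And>p p'. p \<in> LP \<Longrightarrow> p' \<in> LP \<Longrightarrow> \<mu> < height p \<Longrightarrow> \<mu> < height p' \<Longrightarrow>
      real_vec u \<bullet> (base p - base p') \<le> real m - y"
  obtains V x x' \<tau> where "V \<in> influenced_dir A c P u" "V \<noteq> P"
    "x \<in> dual_face A c V" "x' \<in> dual_face A c V" "real_vec u \<bullet> x = h" "real_vec u \<bullet> x' = h"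
    "x - x' = \<tau> *\<^sub>R real_vec (perp u)" "\<bar>\<tau>\<bar> \<ge> y"
proof -
  define L where "L e = real_vec u \<bullet> real_vec e" for e
  define \<kappa> where "\<kappa> = trop_monomial c P"
  have mon: "trop_monomial c (P + t *\<^sub>R real_vec u) e = \<kappa> e + t * L e" for t e
    by (simp add: trop_monomial_shift[of c "P + t *\<^sub>R real_vec u" e P] \<kappa>_def L_def inner_commute)
  have PH: "P \<in> trop_curve A c" using vertex by (simp add: trop_vertices_def)
  hence "maximal_exponents A c P \<noteq> {}" by (auto simp: trop_curve_def)
  then obtain a0 where a0: "a0 \<in> maximal_exponents A c P" by blast
  have "\<exists>b\<in>A. h < L b"
  proof (rule ccontr)
    assume "\<not> (\<exists>b\<in>A. h < L b)"
    hence "L e < h" if "e \<in> A" for e using gen[OF that] that by (force simp: L_def)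
    hence "lift_exp (trop_monomial c P) ` A \<subseteq> {p. real_vec u \<bullet> base p < h}" by (auto simp: L_def)
    moreover have "convex {p. real_vec u \<bullet> base p < h}"
    proof -
      have "linear base" by (rule linearI) auto
      hence "convex (base -` {x. real_vec u \<bullet> x < h})"
        by (intro convex_linear_vimage convex_halfspace_lt)
      thus ?thesis by (simp add: vimage_def)
    qed
    ultimately have "LP \<subseteq> {p. real_vec u \<bullet> base p < h}" unfolding lifted_polygon_def by (rule hull_minimal)
    thus False using p0 by auto
  qed
  then obtain b0 where b0: "b0 \<in> A" "h < L b0" by blast
  have a0A: "a0 \<in> A" using a0 by (simp add: maximal_exponents_def)
  obtain t a b where ab: "a \<in> maximal_exponents A c (P + t *\<^sub>R real_vec u)"
    "b \<in> maximal_exponents A c (P + t *\<^sub>R real_vec u)" "L a < h" "h < L b"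
    using upper_chord[OF fin a0A b0(1) r0[OF a0] b0(2)[unfolded L_def] gen, where c = c and P = P] unfolding L_def by blast
  define Q where "Q = P + t *\<^sub>R real_vec u"
  define F where "F = trop_poly A c Q"
  have abA: "a \<in> A" "b \<in> A" using ab by (auto simp: maximal_exponents_def)
  have abF: "\<kappa> a + t * L a = F" "\<kappa> b + t * L b = F"
    using ab unfolding F_def Q_def by (auto simp: maximal_exponents_def mon)
  have leF: "\<kappa> e + t * L e \<le> F" if "e \<in> A" for e
    using trop_monomial_le[OF fin that, of c Q] by (simp add: F_def Q_def mon)
  \<comment> \<open>At \<open>P\<close> the exponent \<open>a0\<close> is maximal, while at
    \<open>Q\<close> it is beaten or matched by \<open>b\<close>, which is larger in direction
    \<open>u\<close>. For \<open>t = 0\<close> the exponent \<open>b\<close> would belong to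
    \<open>d(P)\<close>, which lies below \<open>h\<close>.\<close>
  have t: "t > 0"
  proof -
    have "\<kappa> b \<le> \<kappa> a0"
      using a0 trop_monomial_le[OF fin abA(2), of c P] by (simp add: \<kappa>_def maximal_exponents_def)
    hence "0 \<le> t * (L b - L a0)" using leF[OF a0A] abF(2) by (simp add: algebra_simps)
    moreover have "L b - L a0 > 0" using ab(4) r0[OF a0] by (simp add: L_def)
    ultimately have "t \<ge> 0" by (simp add: zero_le_mult_iff)
    moreover have "t \<noteq> 0"
    proof
      assume "t = 0"
      hence "L b < h" using ab(2) r0[of b] by (simp add: L_def)
      thus False using ab(4) by simp
    qed
    ultimately show ?thesis by simp
  qed
  define r where "r = (h - L a) / (L b - L a)"
  define x0 where "x0 = (1 - r) *\<^sub>R real_vec a + r *\<^sub>R real_vec b"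
  have x0: "x0 \<in> dual_face A c Q" unfolding x0_def Q_def
    using ab by (intro convexD_alt convex_dual_face real_vec_in_dual_face) (auto simp: r_def)
  have hx0: "real_vec u \<bullet> x0 = h"
  proof -
    have "real_vec u \<bullet> x0 = L a + r * (L b - L a)"
      by (simp add: x0_def inner_add_right L_def algebra_simps)
    also have "\<dots> = h" using ab by (simp add: r_def)
    finally show ?thesis .
  qed
  \<comment> \<open>The left-hand side is the height of the supporting plane over \<open>h\<close>,
    and \<open>p0\<close> lies on or below that plane.\<close>
  have F\<mu>: "F - t * h > \<mu>"
    using lifted_polygon_supporting(1)[OF fin p0(1), of Q] p0 by (simp add: Q_def F_def inner_commute)
  have \<mu>1: "F - t * h = trop_poly A c Q - t * (real_vec u \<bullet> x0)" by (simp add: F_def hx0)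
  have width1: "real_vec u \<bullet> (base p - base p') \<le> real m - y"
    if "p \<in> LP" "p' \<in> LP" "F - t * h \<le> height p" "F - t * h \<le> height p'" for p p'
    using width[OF that(1,2)] that(3,4) F\<mu> by linarith
  obtain x x' \<tau> where x: "x \<in> dual_face A c Q" "x' \<in> dual_face A c Q"
    "real_vec u \<bullet> x = h" "real_vec u \<bullet> x' = h" "x - x' = \<tau> *\<^sub>R real_vec (perp u)" "\<bar>\<tau>\<bar> \<ge> y"
    using face_points[OF u t y Q_def x0 \<mu>1 width1, unfolded hx0] by blast
  have xx: "x \<noteq> x'" using x(5,6) y primitive_nz(2)[OF u] by auto
  have QH: "Q \<in> trop_curve A c" by (rule trop_curve_two_points[OF fin x(1,2) xx])
  have seg: "P + t' *\<^sub>R real_vec u \<in> trop_curve A c" if t': "0 \<le> t'" "t' \<le> t" for t'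
  proof -
    consider "t' = 0" | "t' = t" | "0 < t'" "t' < t" using t' by fastforce
    thus ?thesis
    proof cases
      case 3
      \<comment> \<open>A maximal exponent \<open>e\<close> at \<open>R\<close> precedes
        \<open>a\<close> in direction \<open>u\<close>, so its lift is at least as high as that of
        \<open>a\<close> and lies above \<open>\<mu>\<close>. Applying \<open>face_points\<close> at
        this height gives two points of \<open>d(R)\<close>, hence \<open>R\<close> is on the
        curve.\<close>
      define R where "R = P + t' *\<^sub>R real_vec u"
      obtain e where e: "e \<in> maximal_exponents A c R" using maximal_exponents_nonempty[OF fin] abA by blast
      have eA: "e \<in> A" using e by (simp add: maximal_exponents_def)
      have eF: "trop_poly A c R = \<kappa> e + t' * L e" using e by (simp add: maximal_exponents_def R_def mon)
      have ea: "\<kappa> a + t' * L a \<le> \<kappa> e + t' * L e"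
        using trop_monomial_le[OF fin abA(1), of c R] unfolding eF by (simp add: R_def mon)
      have "(t - t') * L e \<le> (t - t') * L a" using ea leF[OF eA] abF(1) by (simp add: algebra_simps)
      hence "L e \<le> L a" using 3 by simp
      hence "t' * L e \<le> t' * L a" using 3 by simp
      moreover have "t * L a \<le> t * h" using ab(3) t by simp
      ultimately have \<kappa>e: "\<kappa> e > \<mu>" using ea abF(1) F\<mu> by linarith
      have \<mu>e: "\<kappa> e = trop_poly A c R - t' * (real_vec u \<bullet> real_vec e)" by (simp add: eF L_def)
      have width2: "real_vec u \<bullet> (base p - base p') \<le> real m - y"
        if "p \<in> LP" "p' \<in> LP" "\<kappa> e \<le> height p" "\<kappa> e \<le> height p'" for p p'
        using width[OF that(1,2)] that(3,4) \<kappa>e by linarith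
      obtain z z' \<rho> where z: "z \<in> dual_face A c R" "z' \<in> dual_face A c R"
        "z - z' = \<rho> *\<^sub>R real_vec (perp u)" "\<bar>\<rho>\<bar> \<ge> y"
        using face_points[OF u 3(1) y R_def real_vec_in_dual_face[OF e] \<mu>e width2] by blast
      have "z \<noteq> z'" using z(3,4) y primitive_nz(2)[OF u] by auto
      thus ?thesis using trop_curve_two_points[OF fin z(1,2)] by (simp add: R_def)
    qed (use PH QH in \<open>auto simp: Q_def\<close>)
  qed
  have "closed_segment P Q \<subseteq> trop_curve A c \<inter> dir_line P u"
  proof
    fix z assume "z \<in> closed_segment P Q"
    then obtain r where r: "0 \<le> r" "r \<le> 1" "z = (1 - r) *\<^sub>R P + r *\<^sub>R Q" unfolding in_segment by blast
    have "z = P + (r * t) *\<^sub>R real_vec u" unfolding r(3) Q_def by (simp add: algebra_simps)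
    moreover have "0 \<le> r * t" "r * t \<le> t" using r t by (auto simp: mult_left_le_one_le)
    ultimately show "z \<in> trop_curve A c \<inter> dir_line P u" using seg by (auto simp: dir_line_def)
  qed
  hence "Q \<in> long_edge A c P u"
    unfolding long_edge_def mem_Collect_eq connected_component_def
    by (intro exI[of _ "closed_segment P Q"]) auto
  \<comment> \<open>\<open>d(Q)\<close> contains two points over \<open>h\<close> and the exponent
    \<open>a\<close> below \<open>h\<close>.\<close>
  moreover have "aff_dim (dual_face A c Q) = 2"
    using aff_dim_eq_2I[OF x(1,2) real_vec_in_dual_face[OF ab(1), folded Q_def] xx x(3,4)] ab(3)
    by (simp add: L_def)
  ultimately have "Q \<in> influenced_dir A c P u"
    using QH by (simp add: influenced_dir_def trop_vertices_def)
  moreover have "Q \<noteq> P" using t primitive_nz(1)[OF u] by (simp add: Q_def)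
  ultimately show ?thesis using that[OF _ _ x] by blast
qed

end

section \<open>Change of sign and unimodular coordinates\<close>

lemma primitive_uminus [simp]: "primitive (- u) \<longleftrightarrow> primitive u"
  by (simp add: primitive_def)

lemma real_vec_uminus [simp]: "real_vec (- u) = - real_vec u"
  by (simp add: real_vec_def)

lemma perp_uminus [simp]: "perp (- u) = - perp u"
  by (simp add: perp_def)

lemma influenced_dir_uminus [simp]: "influenced_dir A c P (- u) = influenced_dir A c P u"
proof -
  have "dir_line P (- u) \<subseteq> dir_line P u" for u
  proof
    fix z assume "z \<in> dir_line P (- u)"
    then obtain t where "z = P + t *\<^sub>R real_vec (- u)" unfolding dir_line_def by blast
    hence "z = P + (- t) *\<^sub>R real_vec u" by simp
    thus "z \<in> dir_line P u" unfolding dir_line_def by blast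
  qed
  from this[of u] this[of "- u"] have "dir_line P (- u) = dir_line P u" by simp
  thus ?thesis by (simp add: influenced_dir_def long_edge_def)
qed

lemma unimodular_complement:
  assumes "primitive u"
  obtains v where "fst u * snd v - snd u * fst v = 1"
proof -
  obtain x y where "x * fst u + y * snd u = gcd (fst u) (snd u)" using bezout_int by blast
  hence "x * fst u + y * snd u = 1" using assms by (simp add: primitive_def)
  thus ?thesis by (intro that[of "(- y, x)"]) (simp add: mult.commute)
qed

definition coords :: "int \<times> int \<Rightarrow> int \<times> int \<Rightarrow> real \<times> real \<Rightarrow> real \<times> real" where
  "coords u v x = (real_vec u \<bullet> x, real_vec v \<bullet> x)"

lemma coords_lin2: "coords u v = lin2 (fst u) (snd u) (fst v) (snd v)"
  by (simp add: fun_eq_iff coords_def lin2_def real_vec_def inner_prod_def)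

lemma linear_coords: "linear (coords u v)"
  unfolding coords_def by (intro linearI) (simp_all add: inner_add_right)

lemma compact_coords: "compact K \<Longrightarrow> compact (coords u v ` K)"
  by (simp add: coords_lin2 compact_continuous_image continuous_lin2)

lemma convex_coords: "convex K \<Longrightarrow> convex (coords u v ` K)"
  by (simp add: convex_linear_image linear_coords)

lemma area_coords:
  assumes "compact K" "fst u * snd v - snd u * fst v = 1"
  shows "area (coords u v ` K) = area K"
proof -
  have "real_of_int (fst u * snd v - snd u * fst v) = 1" unfolding assms(2) by simp
  thus ?thesis unfolding coords_lin2 by (intro area_image_lin2 assms) simp
qed

text \<open>One lattice step perpendicular to \<open>u\<close> changes the
  \<open>v\<close>-coordinate by 1, so slice lengths in these coordinates are lattice
  lengths.\<close>

lemma inner_perp_unimodular: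
  assumes "fst u * snd v - snd u * fst v = 1"
  shows "real_vec v \<bullet> real_vec (perp u) = 1"
proof -
  have "real_of_int (fst u * snd v - snd u * fst v) = 1" unfolding assms by simp
  thus ?thesis by (simp add: real_vec_def perp_def algebra_simps)
qed

lemma emeasure_greaterThanLessThan_ge: "emeasure lborel {l<..<r} \<ge> ennreal (r - l)" for l r :: real
  by (cases "l \<le> r") (auto simp: ennreal_neg)

section \<open>The area contributed by one direction\<close>

context thick_vertex
begin

text \<open>The segment from the lift of \<open>d\<close> at the top level to \<open>q\<close>
  passes over \<open>h\<close>. There it is strictly above \<open>\<mu>\<close>, because only its
  end \<open>q\<close> can be at level \<open>\<mu>\<close>; this provides the point
  \<open>p0\<close> for \<open>influenced_vertex\<close>.\<close>

lemma influenced_slice: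
  assumes u: "primitive u" and y: "y > 0" and gen: "\<And>e. e \<in> A \<Longrightarrow> real_vec u \<bullet> real_vec e \<noteq> h"
    and d: "d \<in> dual_face A c P" "\<And>x. x \<in> dual_face A c P \<Longrightarrow> real_vec u \<bullet> x \<le> real_vec u \<bullet> d"
    and q: "q \<in> LP" "height q \<ge> \<mu>" and \<mu>: "\<mu> < trop_poly A c P"
    and h: "real_vec u \<bullet> d < h" "h < real_vec u \<bullet> base q"
    and width: "\<And>p p'. p \<in> LP \<Longrightarrow> p' \<in> LP \<Longrightarrow> \<mu> < height p \<Longrightarrow> \<mu> < height p' \<Longrightarrow>
      real_vec u \<bullet> (base p - base p') \<le> real m - y"
  obtains V x x' \<tau> where "V \<in> influenced_dir A c P u - {P}"
    "x \<in> dual_face A c V" "x' \<in> dual_face A c V" "real_vec u \<bullet> x = h" "real_vec u \<bullet> x' = h"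
    "x - x' = \<tau> *\<^sub>R real_vec (perp u)" "\<bar>\<tau>\<bar> \<ge> y"
proof -
  obtain p where p: "p \<in> LP" "base p = d" "height p = trop_poly A c P" using d(1) by (rule top_lift)
  define r where "r = (h - real_vec u \<bullet> d) / (real_vec u \<bullet> base q - real_vec u \<bullet> d)"
  have r: "0 \<le> r" "r < 1" using h by (auto simp: r_def)
  define p0 where "p0 = (1 - r) *\<^sub>R p + r *\<^sub>R q"
  have "p0 \<in> LP" unfolding p0_def using p q r by (intro convexD_alt convex_lifted_polygon) auto
  moreover have "real_vec u \<bullet> base p0 = h"
  proof -
    have "base p0 = (1 - r) *\<^sub>R d + r *\<^sub>R base q" by (simp add: p0_def p)
    then have "real_vec u \<bullet> base p0 = real_vec u \<bullet> d + r * (real_vec u \<bullet> base q - real_vec u \<bullet> d)"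
      by (simp only:) (simp add: inner_add_right left_diff_distrib right_diff_distrib)
    also have "\<dots> = h" using h by (simp add: r_def)
    finally show ?thesis .
  qed
  moreover have "height p0 > \<mu>"
  proof -
    have "\<mu> = (1 - r) * \<mu> + r * \<mu>" by (simp add: algebra_simps)
    also have "\<dots> < (1 - r) * height p + r * height q"
      using p(3) \<mu> q r by (intro add_less_le_mono mult_strict_left_mono mult_left_mono) auto
    finally show ?thesis by (simp add: p0_def)
  qed
  moreover have "real_vec u \<bullet> real_vec e < h" if "e \<in> maximal_exponents A c P" for e
    using d(2)[OF real_vec_in_dual_face[OF that]] h(1) by simp
  ultimately obtain V x x' \<tau> where "V \<in> influenced_dir A c P u" "V \<noteq> P"
    "x \<in> dual_face A c V" "x' \<in> dual_face A c V" "real_vec u \<bullet> x = h" "real_vec u \<bullet> x' = h"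
    "x - x' = \<tau> *\<^sub>R real_vec (perp u)" "\<bar>\<tau>\<bar> \<ge> y"
    using influenced_vertex[OF u y gen _ _ _ _ width] by blast
  thus ?thesis using that by blast
qed

text \<open>\<open>\<mu>\<close> is the highest level at which the section has width at least \<open>w\<close>.\<close>

lemma critical_level:
  assumes D: "\<And>x x'. x \<in> dual_face A c P \<Longrightarrow> x' \<in> dual_face A c P \<Longrightarrow> real_vec u \<bullet> (x - x') < w"
    and ab: "a \<in> A" "b \<in> A" "real_vec u \<bullet> (real_vec a - real_vec b) \<ge> w"
  obtains \<mu> q q' where "\<mu> < trop_poly A c P" "q \<in> LP" "q' \<in> LP" "\<mu> \<le> height q" "\<mu> \<le> height q'"
    "real_vec u \<bullet> (base q - base q') \<ge> w"
    "\<And>p p'. p \<in> LP \<Longrightarrow> p' \<in> LP \<Longrightarrow> \<mu> < height p \<Longrightarrow> \<mu> < height p' \<Longrightarrow>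
      real_vec u \<bullet> (base p - base p') \<le> w"
proof -
  \<comment> \<open>\<open>f\<close> is the highest level whose section contains both points of a
    pair; the critical level is its maximum over the compact set of pairs at
    \<open>u\<close>-distance at least \<open>w\<close>.\<close>
  define K where "K = (LP \<times> LP) \<inter> {z. w \<le> real_vec u \<bullet> (base (fst z) - base (snd z))}"
  define f where "f z = min (height (fst z)) (height (snd z))" for z
  have cb: "continuous_on UNIV (\<lambda>z. base (g z))" if "continuous_on UNIV g" for g :: "_ \<Rightarrow> real \<times> real \<times> real"
    unfolding base_def by (intro continuous_intros that)
  have ch: "continuous_on S (\<lambda>z. height (g z))" if "continuous_on S g" for S and g :: "_ \<Rightarrow> real \<times> real \<times> real"
    unfolding height_def by (intro continuous_intros that)
  have "compact K" unfolding K_def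
    by (intro compact_Int_closed compact_Times compact_lifted_polygon fin closed_Collect_le
        continuous_intros cb)
  moreover have "(lift_exp (trop_monomial c P) a, lift_exp (trop_monomial c P) b) \<in> K"
    using ab by (simp add: K_def lift_exp_in)
  moreover have "continuous_on K f" unfolding f_def by (intro continuous_intros ch)
  ultimately obtain z where z: "z \<in> K" "\<And>z'. z' \<in> K \<Longrightarrow> f z' \<le> f z"
    using continuous_attains_sup[of K f] by blast
  obtain q q' where qq: "z = (q, q')" by (cases z)
  have q: "q \<in> LP" "q' \<in> LP" "w \<le> real_vec u \<bullet> (base q - base q')" using z(1) by (auto simp: K_def qq)
  have "f z < trop_poly A c P"
  proof (rule ccontr)
    assume "\<not> f z < trop_poly A c P"
    hence "height q = trop_poly A c P" "height q' = trop_poly A c P"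
      using height_le[OF q(1)] height_le[OF q(2)] by (auto simp: f_def qq)
    hence "base q \<in> dual_face A c P" "base q' \<in> dual_face A c P" using q base_top by auto
    thus False using D[of "base q" "base q'"] q(3) by simp
  qed
  moreover have "real_vec u \<bullet> (base p - base p') \<le> w"
    if "p \<in> LP" "p' \<in> LP" "f z < height p" "f z < height p'" for p p'
  proof (rule ccontr)
    assume "\<not> real_vec u \<bullet> (base p - base p') \<le> w"
    hence "(p, p') \<in> K" using that by (simp add: K_def)
    from z(2)[OF this] have "f (p, p') \<le> f z" .
    moreover have "f z < f (p, p')" using that(3,4) by (simp only: f_def fst_conv snd_conv min_less_iff_conj)
    ultimately show False by simp
  qed
  ultimately show ?thesis using that[of "f z" q q'] q by (simp add: f_def qq)
qed

text \<open>At the critical level for the width \<open>m - y\<close> the section exceeds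
  \<open>d(P)\<close> by at least \<open>a - y\<close>, both ends together. Almost every level in
  this excess meets a dual face in a slice of length at least \<open>y\<close>, so
  \<open>sum_area_ge_half_square\<close> applies.\<close>

lemma influenced_dir_area:
  assumes u: "primitive u"
    and e: "e \<in> A" "e' \<in> A" "real_vec u \<bullet> (real_vec e - real_vec e') \<ge> real m"
    and d: "d \<in> dual_face A c P" "\<And>x. x \<in> dual_face A c P \<Longrightarrow> real_vec u \<bullet> x \<le> real_vec u \<bullet> d"
    and d': "d' \<in> dual_face A c P" "\<And>x. x \<in> dual_face A c P \<Longrightarrow> real_vec u \<bullet> d' \<le> real_vec u \<bullet> x"
    and a: "a = real m - real_vec u \<bullet> (d - d')" "a \<ge> 0"
  shows "(\<Sum>V\<in>influenced_dir A c P u - {P}. area (dual_face A c V)) \<ge> a\<^sup>2 / 2"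
proof -
  obtain v where v: "fst u * snd v - snd u * fst v = 1" using u by (rule unimodular_complement)
  define F where "F = influenced_dir A c P u - {P}"
  define K where "K V = coords u v ` dual_face A c V" for V
  have fF: "finite F" using finite_trop_vertices[OF fin, of c]
    by (auto simp: F_def influenced_dir_def intro: finite_subset)
  have K: "compact (K V)" "convex (K V)" for V
    unfolding K_def by (intro compact_coords convex_coords compact_dual_face fin convex_dual_face)+
  have slice: "y \<le> (\<Sum>V\<in>F. slice_length (K V) h)"
    if V: "V \<in> F" "x \<in> dual_face A c V" "x' \<in> dual_face A c V" "real_vec u \<bullet> x = h" "real_vec u \<bullet> x' = h"
      and \<tau>: "x - x' = \<tau> *\<^sub>R real_vec (perp u)" "\<bar>\<tau>\<bar> \<ge> y" for V x x' \<tau> y h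
  proof -
    have "real_vec v \<bullet> x - real_vec v \<bullet> x' = \<tau>"
      using inner_perp_unimodular[OF v] \<tau>(1) by (simp flip: inner_diff_right)
    moreover have "(h, real_vec v \<bullet> x) \<in> K V" "(h, real_vec v \<bullet> x') \<in> K V"
      using imageI[OF V(2), of "coords u v"] imageI[OF V(3), of "coords u v"] V(4,5)
      unfolding K_def by (simp_all add: coords_def)
    ultimately have "slice_length (K V) h \<ge> y" using slice_length_ge[OF K] \<tau>(2) by fastforce
    also have "slice_length (K V) h \<le> (\<Sum>V\<in>F. slice_length (K V) h)"
      using V(1) fF by (intro member_le_sum) (auto simp: slice_length_nonneg)
    finally show ?thesis .
  qed
  have "(\<Sum>V\<in>F. area (K V)) \<ge> a\<^sup>2 / 2"
  proof (rule sum_area_ge_half_square[OF fF K(1) a(2)])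
    fix y assume y: "0 < y" "y < a"
    have "real_vec u \<bullet> (x - x') < real m - y" if "x \<in> dual_face A c P" "x' \<in> dual_face A c P" for x x'
      using d(2)[OF that(1)] d'(2)[OF that(2)] a(1) y(2) by (simp add: inner_diff_right)
    moreover have "real_vec u \<bullet> (real_vec e - real_vec e') \<ge> real m - y" using e(3) y(1) by simp
    ultimately obtain \<mu> q q' where \<mu>: "\<mu> < trop_poly A c P" and q: "q \<in> LP" "q' \<in> LP" "\<mu> \<le> height q" "\<mu> \<le> height q'"
      "real_vec u \<bullet> (base q - base q') \<ge> real m - y"
      and width: "\<And>p p'. p \<in> LP \<Longrightarrow> p' \<in> LP \<Longrightarrow> \<mu> < height p \<Longrightarrow> \<mu> < height p' \<Longrightarrow>
      real_vec u \<bullet> (base p - base p') \<le> real m - y"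
      using critical_level[of u "real m - y" e e'] e(1,2) by blast
    \<comment> \<open>The finitely many levels of exponents are set aside as a null set.\<close>
    define N where "N = (\<lambda>e. real_vec u \<bullet> real_vec e) ` A"
    define I where "I = {real_vec u \<bullet> d <..< real_vec u \<bullet> base q}"
    define J where "J = {real_vec u \<bullet> base q' <..< real_vec u \<bullet> d'}"
    have "(I \<union> J) - N \<subseteq> {h. y \<le> (\<Sum>V\<in>F. slice_length (K V) h)}"
    proof (rule subsetI, rule CollectI)
      fix h assume h: "h \<in> (I \<union> J) - N"
      hence gen: "real_vec u \<bullet> real_vec e \<noteq> h" if "e \<in> A" for e using that by (auto simp: N_def)
      from h consider "h \<in> I" | "h \<in> J" by blast
      thus "y \<le> (\<Sum>V\<in>F. slice_length (K V) h)"
      proof cases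
        case 1
        hence "real_vec u \<bullet> d < h" "h < real_vec u \<bullet> base q" by (auto simp: I_def)
        from influenced_slice[OF u y(1) gen d q(1,3) \<mu> this width] obtain V x x' \<tau> where
          "V \<in> F" "x \<in> dual_face A c V" "x' \<in> dual_face A c V" "real_vec u \<bullet> x = h" "real_vec u \<bullet> x' = h"
          "x - x' = \<tau> *\<^sub>R real_vec (perp u)" "\<bar>\<tau>\<bar> \<ge> y" unfolding F_def by blast
        thus ?thesis by (rule slice)
      next
        case 2
        \<comment> \<open>The excess on the other side is treated with \<open>- u\<close> in place
          of \<open>u\<close>, which changes the signs of \<open>h\<close> and
          \<open>\<tau>\<close>.\<close>
        have u': "primitive (- u)" using u by simp
        have gen': "real_vec (- u) \<bullet> real_vec e \<noteq> - h" if "e \<in> A" for e using gen[OF that] by simp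
        have h': "real_vec (- u) \<bullet> d' < - h" "- h < real_vec (- u) \<bullet> base q'" using 2 by (auto simp: J_def)
        have d'': "real_vec (- u) \<bullet> x \<le> real_vec (- u) \<bullet> d'" if "x \<in> dual_face A c P" for x
          using d'(2)[OF that] by simp
        have width': "real_vec (- u) \<bullet> (base p - base p') \<le> real m - y"
          if "p \<in> LP" "p' \<in> LP" "\<mu> < height p" "\<mu> < height p'" for p p'
          using width[OF that(2,1,4,3)] by (simp add: inner_diff_right)
        from influenced_slice[OF u' y(1) gen' d'(1) d'' q(2,4) \<mu> h' width'] obtain V x x' \<tau> where
          V: "V \<in> influenced_dir A c P (- u) - {P}" "x \<in> dual_face A c V" "x' \<in> dual_face A c V"
          "real_vec (- u) \<bullet> x = - h" "real_vec (- u) \<bullet> x' = - h"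
          "x - x' = \<tau> *\<^sub>R real_vec (perp (- u))" "\<bar>\<tau>\<bar> \<ge> y" by blast
        show ?thesis
        proof (rule slice[of V x x' h "- \<tau>"])
          show "V \<in> F" using V(1) by (simp add: F_def)
        qed (use V in auto)
      qed
    qed
    moreover have "{h. y \<le> (\<Sum>V\<in>F. slice_length (K V) h)} \<in> sets lborel"
    proof -
      have "(\<lambda>h. \<Sum>V\<in>F. slice_length (K V) h) \<in> borel_measurable borel"
        by (intro borel_measurable_sum slice_length_measurable K)
      thus ?thesis by measurable
    qed
    ultimately have le: "emeasure lborel ((I \<union> J) - N) \<le> emeasure lborel {h. y \<le> (\<Sum>V\<in>F. slice_length (K V) h)}"
      by (rule emeasure_mono)
    have N: "N \<in> null_sets lborel" unfolding N_def using fin by (intro finite_imp_null_set_lborel) auto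
    have "real_vec u \<bullet> d' \<le> real_vec u \<bullet> d" using d(2)[OF d'(1)] .
    hence "I \<inter> J = {}" by (auto simp: I_def J_def)
    hence IJ: "emeasure lborel (I \<union> J) = emeasure lborel I + emeasure lborel J"
      by (intro plus_emeasure[symmetric]) (auto simp: I_def J_def)
    \<comment> \<open>The widths \<open>m - y\<close> and \<open>m - a\<close> differ by
      \<open>a - y\<close>. If one end of the section does not pass \<open>d(P)\<close>, the
      interval there is empty and counts as 0.\<close>
    have "ennreal (a - y) \<le> ennreal (max 0 (real_vec u \<bullet> base q - real_vec u \<bullet> d) + max 0 (real_vec u \<bullet> d' - real_vec u \<bullet> base q'))"
      using q(5) a(1) by (intro ennreal_leI) (simp add: inner_diff_right max_def)
    also have "\<dots> = ennreal (real_vec u \<bullet> base q - real_vec u \<bullet> d) + ennreal (real_vec u \<bullet> d' - real_vec u \<bullet> base q')"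
      by (simp add: ennreal_max_0)
    also have "\<dots> \<le> emeasure lborel I + emeasure lborel J"
      unfolding I_def J_def by (intro add_mono emeasure_greaterThanLessThan_ge)
    also have "\<dots> = emeasure lborel ((I \<union> J) - N)"
      unfolding IJ[symmetric] using N by (intro emeasure_Diff_null_set[symmetric]) (auto simp: I_def J_def)
    also note le
    finally show "ennreal (a - y) \<le> emeasure lborel {h. y \<le> (\<Sum>V\<in>F. slice_length (K V) h)}" .
  qed
  thus ?thesis by (simp add: K_def F_def area_coords[OF compact_dual_face[OF fin] v])
qed

end

section \<open>The area of the influenced set\<close>

lemma area_translation: "area ((+) d ` K) = area K"
  unfolding area_def using measure_translation[of d K] by simp

text \<open>Two lines through \<open>P\<close> of different directions meet only in
  \<open>P\<close>.\<close>

lemma influenced_dir_Int: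
  assumes "real_vec u \<bullet> real_vec (perp v) \<noteq> 0"
  shows "influenced_dir A c P u \<inter> influenced_dir A c P v \<subseteq> {P}"
proof
  fix Q assume "Q \<in> influenced_dir A c P u \<inter> influenced_dir A c P v"
  hence "Q \<in> dir_line P u" "Q \<in> dir_line P v"
    using connected_component_subset unfolding influenced_dir_def long_edge_def by blast+
  then obtain s t where s: "Q = P + s *\<^sub>R real_vec u" and t: "Q = P + t *\<^sub>R real_vec v"
    unfolding dir_line_def by blast
  hence "s *\<^sub>R real_vec u = t *\<^sub>R real_vec v" by simp
  hence "s * (real_vec u \<bullet> real_vec (perp v)) = t * (real_vec v \<bullet> real_vec (perp v))"
    by (metis inner_scaleR_left)
  hence "s = 0" using assms by (simp add: inner_perp)
  thus "Q \<in> {P}" using s by simp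
qed

text \<open>A linear functional on the hull is extremal at exponents, so the width in direction
  \<open>u\<close> is attained by two of them.\<close>

lemma newton_polygon_wide:
  assumes "finite A" "A \<noteq> {}" and wide: "min_lattice_width (newton_polygon A) \<ge> w" and u: "primitive u"
  obtains e e' where "e \<in> A" "e' \<in> A" "real_vec u \<bullet> (real_vec e - real_vec e') \<ge> w"
proof -
  have ext: "\<exists>e\<in>A. \<exists>e'\<in>A. lattice_width u (newton_polygon A) \<le> real_vec u \<bullet> (real_vec e - real_vec e')
      \<and> (\<forall>z\<in>newton_polygon A \<times> newton_polygon A. real_vec u \<bullet> (fst z - snd z) \<le> real_vec u \<bullet> (real_vec e - real_vec e'))" for u
  proof -
    define f where "f e = real_vec u \<bullet> real_vec e" for e
    have "Max (f ` A) \<in> f ` A" "Min (f ` A) \<in> f ` A" using assms by auto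
    then obtain e e' where e: "e \<in> A" "f e = Max (f ` A)" "e' \<in> A" "f e' = Min (f ` A)" by (metis imageE)
    have sub: "newton_polygon A \<subseteq> {x. f e' \<le> real_vec u \<bullet> x} \<inter> {x. real_vec u \<bullet> x \<le> f e}"
      unfolding newton_polygon_def
    proof (rule hull_minimal)
      show "real_vec ` A \<subseteq> {x. f e' \<le> real_vec u \<bullet> x} \<inter> {x. real_vec u \<bullet> x \<le> f e}"
        unfolding e using assms(1) by (auto simp flip: f_def)
    qed (intro convex_Int convex_halfspace_le convex_halfspace_ge)
    have *: "\<forall>z\<in>newton_polygon A \<times> newton_polygon A. real_vec u \<bullet> (fst z - snd z) \<le> real_vec u \<bullet> (real_vec e - real_vec e')"
    proof
      fix z assume "z \<in> newton_polygon A \<times> newton_polygon A"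
      hence "fst z \<in> newton_polygon A" "snd z \<in> newton_polygon A" by auto
      hence "real_vec u \<bullet> fst z \<le> f e" "f e' \<le> real_vec u \<bullet> snd z" using sub by blast+
      thus "real_vec u \<bullet> (fst z - snd z) \<le> real_vec u \<bullet> (real_vec e - real_vec e')"
        by (simp add: inner_diff_right f_def)
    qed
    have "newton_polygon A \<noteq> {}" using assms(2) by (simp add: newton_polygon_def)
    hence "lattice_width u (newton_polygon A) \<le> real_vec u \<bullet> (real_vec e - real_vec e')"
      unfolding lattice_width_def using * by (intro cSUP_least) auto
    thus ?thesis using * e by blast
  qed
  \<comment> \<open>The lower bound 0 makes the infimum over all directions meaningful, hence at
    most the width for \<open>u\<close>.\<close>
  have "lattice_width u (newton_polygon A) \<ge> 0" for u
  proof -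
    obtain e where e: "e \<in> A" using assms(2) by blast
    have x: "real_vec e \<in> newton_polygon A" using e by (simp add: newton_polygon_def hull_inc)
    have "bdd_above ((\<lambda>(x, y). real_vec u \<bullet> (x - y)) ` (newton_polygon A \<times> newton_polygon A))"
      using ext[of u] by (auto simp: bdd_above_def)
    hence "(\<lambda>(x, y). real_vec u \<bullet> (x - y)) (real_vec e, real_vec e) \<le> lattice_width u (newton_polygon A)"
      unfolding lattice_width_def using x by (intro cSUP_upper) auto
    thus ?thesis by simp
  qed
  hence "bdd_below ((\<lambda>u. lattice_width u (newton_polygon A)) ` Collect primitive)"
    by (intro bdd_belowI[of _ 0]) auto
  hence "min_lattice_width (newton_polygon A) \<le> lattice_width u (newton_polygon A)"
    unfolding min_lattice_width_def using u by (intro cINF_lower) auto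
  thus ?thesis using ext[of u] that wide by force
qed

section \<open>Support function, widths and defects of the face dual to the vertex\<close>

context thick_vertex
begin

text \<open>The support function of \<open>d(P)\<close>, so that \<open>face_width\<close> is its
  lattice width.\<close>

definition supp :: "int \<times> int \<Rightarrow> real" where
  "supp v = Max ((\<lambda>e. real_vec v \<bullet> real_vec e) ` maximal_exponents A c P)"

definition face_width :: "int \<times> int \<Rightarrow> real" where
  "face_width v = supp v + supp (- v)"

definition defect :: "int \<times> int \<Rightarrow> real" where
  "defect v = max 0 (real m - face_width v)"

lemma maximal_exponents_vertex_nonempty: "maximal_exponents A c P \<noteq> {}"
  using vertex by (auto simp: trop_vertices_def trop_curve_def)

lemma supp_attained:
  obtains e where "e \<in> maximal_exponents A c P" "supp v = real_vec v \<bullet> real_vec e"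
proof -
  have "supp v \<in> (\<lambda>e. real_vec v \<bullet> real_vec e) ` maximal_exponents A c P"
    unfolding supp_def using maximal_exponents_vertex_nonempty finite_maximal_exponents[OF fin]
    by (intro Max_in) auto
  thus ?thesis using that by blast
qed

lemma supp_point:
  obtains d where "d \<in> dual_face A c P" "real_vec v \<bullet> d = supp v"
  using supp_attained[of v] real_vec_in_dual_face by metis

lemma supp_ge:
  assumes "x \<in> dual_face A c P" shows "real_vec v \<bullet> x \<le> supp v"
proof -
  have "dual_face A c P \<subseteq> {x. real_vec v \<bullet> x \<le> supp v}" unfolding dual_face_def
  proof (rule hull_minimal)
    show "real_vec ` maximal_exponents A c P \<subseteq> {x. real_vec v \<bullet> x \<le> supp v}"
    proof (rule image_subsetI, rule CollectI)
      fix e assume "e \<in> maximal_exponents A c P"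
      thus "real_vec v \<bullet> real_vec e \<le> supp v"
        unfolding supp_def using finite_maximal_exponents[OF fin] by (intro Max_ge) auto
    qed
  qed (rule convex_halfspace_le)
  thus ?thesis using assms by blast
qed

lemma supp_uminus_le:
  assumes "x \<in> dual_face A c P" shows "- supp (- v) \<le> real_vec v \<bullet> x"
  using supp_ge[OF assms, of "- v"] by simp

text \<open>Exponents are lattice points. Integrality of the widths ensures that a direction of
  least width exists.\<close>

lemma face_width_nat: "\<exists>k. face_width v = real k"
proof -
  have "\<exists>k. supp v = of_int k" for v
  proof -
    obtain e where "supp v = real_vec v \<bullet> real_vec e" by (rule supp_attained)
    hence "supp v = of_int (fst v * fst e + snd v * snd e)" by (simp add: real_vec_def)
    thus ?thesis by blast
  qed
  then obtain k l where "supp v = of_int k" "supp (- v) = of_int l" by meson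
  hence kl: "face_width v = of_int (k + l)" by (simp add: face_width_def)
  obtain d where d: "d \<in> dual_face A c P" by (rule supp_point)
  have "face_width v \<ge> 0" using supp_ge[OF d, of v] supp_uminus_le[OF d, of v] by (simp add: face_width_def)
  hence "k + l \<ge> 0" using kl by simp
  hence "face_width v = real (nat (k + l))" using kl by simp
  thus ?thesis by blast
qed

lemma minimal_width_direction:
  obtains u where "primitive u" "\<And>v. primitive v \<Longrightarrow> face_width u \<le> face_width v"
proof -
  have "primitive (1, 0)" by (simp add: primitive_def)
  then obtain u where u: "primitive u" "\<And>v. primitive v \<Longrightarrow> nat \<lfloor>face_width u\<rfloor> \<le> nat \<lfloor>face_width v\<rfloor>"
    using ex_has_least_nat[of primitive "(1, 0)" "\<lambda>v. nat \<lfloor>face_width v\<rfloor>"] by blast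
  have "face_width v = real (nat \<lfloor>face_width v\<rfloor>)" for v using face_width_nat[of v] by force
  thus ?thesis using that[of u] u by (metis of_nat_le_iff)
qed

lemma face_width_pos:
  assumes "primitive v" shows "face_width v > 0"
proof (rule ccontr)
  assume "\<not> face_width v > 0"
  hence "dual_face A c P \<subseteq> {x. real_vec v \<bullet> x = supp v}"
    using supp_ge[of _ v] supp_uminus_le[of _ v] by (force simp: face_width_def)
  hence "aff_dim (dual_face A c P) \<le> aff_dim {x. real_vec v \<bullet> x = supp v}" by (rule aff_dim_subset)
  also have "\<dots> = 1" using primitive_nz[OF assms] by simp
  finally show False using vertex by (simp add: trop_vertices_def)
qed

text \<open>The side provided by thickness is cut down to lattice length exactly
  \<open>defect v\<close>; for defect 0 any extreme point will do.\<close>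

lemma top_side:
  assumes v: "primitive v"
  obtains x where "x \<in> dual_face A c P" "x + defect v *\<^sub>R real_vec (perp v) \<in> dual_face A c P"
    "real_vec v \<bullet> x = supp v"
proof (cases "defect v = 0")
  case True
  obtain d where "d \<in> dual_face A c P" "real_vec v \<bullet> d = supp v" by (rule supp_point)
  thus ?thesis using that True by simp
next
  case False
  define b where "b = defect v"
  have b: "b > 0" "face_width v = real m - b" using False by (auto simp: b_def defect_def max_def split: if_splits)
  obtain d where d: "d \<in> dual_face A c P" "real_vec v \<bullet> d = supp v" by (rule supp_point)
  have thick: "thick m (dual_face A c P)" using mult section_top by (metis trop_mult_ge_def)
  have dim: "aff_dim (dual_face A c P) = 2" using vertex by (simp add: trop_vertices_def)
  have w: "real_vec v \<bullet> (x - x') \<le> real m - b" if "x \<in> dual_face A c P" "x' \<in> dual_face A c P" for x x'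
    using supp_ge[OF that(1), of v] supp_uminus_le[OF that(2), of v] b(2)
    by (simp add: face_width_def inner_diff_right)
  obtain x x' \<tau> where x: "x \<in> dual_face A c P" "x' \<in> dual_face A c P" "real_vec v \<bullet> x = supp v"
     "real_vec v \<bullet> x' = supp v" "x - x' = \<tau> *\<^sub>R real_vec (perp v)" "\<bar>\<tau>\<bar> \<ge> b"
    using thick_edge_points[OF thick compact_dual_face[OF fin] convex_dual_face dim v b(1) w supp_ge d] by blast
  note concl = that
  have *: ?thesis if "z \<in> dual_face A c P" "z + \<rho> *\<^sub>R real_vec (perp v) \<in> dual_face A c P"
      "real_vec v \<bullet> z = supp v" "\<rho> \<ge> b" for z \<rho>
  proof (rule concl)
    show "z \<in> dual_face A c P" "real_vec v \<bullet> z = supp v" by fact+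
    have "(1 - b / \<rho>) *\<^sub>R z + (b / \<rho>) *\<^sub>R (z + \<rho> *\<^sub>R real_vec (perp v)) \<in> dual_face A c P"
      using that b by (intro convexD_alt convex_dual_face) auto
    moreover have "(1 - b / \<rho>) *\<^sub>R z + (b / \<rho>) *\<^sub>R (z + \<rho> *\<^sub>R real_vec (perp v)) = z + b *\<^sub>R real_vec (perp v)"
      using that b by (simp add: algebra_simps)
    ultimately show "z + defect v *\<^sub>R real_vec (perp v) \<in> dual_face A c P" by (simp add: b_def)
  qed
  show ?thesis
  proof (cases "\<tau> \<ge> 0")
    case True
    have "x' + \<tau> *\<^sub>R real_vec (perp v) = x" using x(5) by (metis add.commute diff_add_cancel)
    thus ?thesis using *[of x' \<tau>] x True by simp
  next
    case False
    have "x + (- \<tau>) *\<^sub>R real_vec (perp v) = x'" using x(5) by (simp add: algebra_simps)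
    thus ?thesis using *[of x "- \<tau>"] x False by simp
  qed
qed

lemma face_width_uminus [simp]: "face_width (- v) = face_width v"
  by (simp add: face_width_def)

lemma defect_uminus [simp]: "defect (- v) = defect v"
  by (simp add: defect_def)

lemma bottom_side:
  assumes v: "primitive v"
  obtains x where "x \<in> dual_face A c P" "x + defect v *\<^sub>R real_vec (perp v) \<in> dual_face A c P"
    "real_vec v \<bullet> x = - supp (- v)"
proof -
  have "primitive (- v)" using v by simp
  then obtain x where x: "x \<in> dual_face A c P" "x + defect v *\<^sub>R real_vec (perp (- v)) \<in> dual_face A c P"
    "real_vec (- v) \<bullet> x = supp (- v)" by (rule top_side[of "- v"]) auto
  show ?thesis
  \<comment> \<open>Reversing \<open>v\<close> reverses \<open>perp v\<close>, so the roles of the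
    two ends of the side are exchanged.\<close>
  proof (rule that[of "x + defect v *\<^sub>R real_vec (perp (- v))"])
    show "real_vec v \<bullet> (x + defect v *\<^sub>R real_vec (perp (- v))) = - supp (- v)"
      using x(3) by (simp add: inner_diff_right inner_perp algebra_simps)
  qed (use x in auto)
qed

lemma influenced_dir_defect:
  assumes "primitive v" and "A \<noteq> {}" and "min_lattice_width (newton_polygon A) \<ge> real m"
  shows "(\<Sum>V\<in>influenced_dir A c P v - {P}. area (dual_face A c V)) \<ge> (defect v)\<^sup>2 / 2"
proof (cases "defect v = 0")
  case True
  thus ?thesis by (simp add: sum_nonneg area_nonneg)
next
  case False
  hence b: "defect v = real m - face_width v" "defect v \<ge> 0" by (auto simp: defect_def)
  obtain e e' where e: "e \<in> A" "e' \<in> A" "real_vec v \<bullet> (real_vec e - real_vec e') \<ge> real m"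
    using newton_polygon_wide[OF fin assms(2,3,1)] .
  obtain d where d: "d \<in> dual_face A c P" "real_vec v \<bullet> d = supp v" by (rule supp_point)
  obtain d' where d': "d' \<in> dual_face A c P" "real_vec (- v) \<bullet> d' = supp (- v)" by (rule supp_point)
  show ?thesis
  proof (rule influenced_dir_area[OF assms(1) e d(1) _ d'(1)])
    show "real_vec v \<bullet> x \<le> real_vec v \<bullet> d" if "x \<in> dual_face A c P" for x
      using supp_ge[OF that] d(2) by simp
    show "real_vec v \<bullet> d' \<le> real_vec v \<bullet> x" if "x \<in> dual_face A c P" for x
      using supp_ge[OF that, of "- v"] d'(2) by simp
    show "defect v = real m - real_vec v \<bullet> (d - d')"
      using d(2) d'(2) b(1) by (simp add: face_width_def inner_diff_right)
  qed (rule b(2))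
qed

end

section \<open>Area of the face dual to the vertex\<close>

context thick_vertex
begin

text \<open>Coordinates along \<open>u\<close> and a complementary \<open>v\<close>, with the origin
  at the lower end \<open>l\<close> of the left side, bring \<open>d(P)\<close> into the position of
  \<open>planar_bound\<close>; \<open>z = v - u\<close> measures \<open>y - x\<close>.\<close>

lemma dual_face_area_bounds:
  assumes u: "primitive u" "\<And>v. primitive v \<Longrightarrow> face_width u \<le> face_width v"
  obtains v z where "primitive v" "primitive z"
    "real_vec u \<bullet> real_vec (perp v) \<noteq> 0" "real_vec u \<bullet> real_vec (perp z) \<noteq> 0" "real_vec v \<bullet> real_vec (perp z) \<noteq> 0"
    "area (dual_face A c P) + ((defect u)\<^sup>2 + (defect v)\<^sup>2 + (defect z)\<^sup>2) / 2 \<ge> 3 / 8 * (real m)\<^sup>2"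
    "2 * area (dual_face A c P) + (defect u)\<^sup>2 / 2 \<ge> (real m)\<^sup>2 / 2"
proof -
  define D where "D = dual_face A c P"
  define w where "w = face_width u"
  define a where "a = defect u"
  obtain v0 where v0: "fst u * snd v0 - snd u * fst v0 = 1" using u(1) by (rule unimodular_complement)
  obtain l where l: "l \<in> D" "l + a *\<^sub>R real_vec (perp u) \<in> D" "real_vec u \<bullet> l = - supp (- u)"
    unfolding D_def a_def using u(1) by (rule bottom_side)
  obtain r where r: "r \<in> D" "r + a *\<^sub>R real_vec (perp u) \<in> D" "real_vec u \<bullet> r = supp u"
    unfolding D_def a_def using u(1) by (rule top_side)
  have w: "w > 0" "real_vec u \<bullet> r - real_vec u \<bullet> l = w"
    using face_width_pos[OF u(1)] l(3) r(3) by (auto simp: w_def face_width_def)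
  \<comment> \<open>\<open>s\<close> is the slope from \<open>l\<close> to \<open>r\<close>.
    Subtracting \<open>\<lfloor>s\<rfloor>\<close> times \<open>u\<close> from \<open>v0\<close> is
    a lattice shear that leaves its fractional part \<open>\<sigma>\<close>.\<close>
  define s where "s = (real_vec v0 \<bullet> r - real_vec v0 \<bullet> l) / w"
  define \<sigma> where "\<sigma> = s - of_int \<lfloor>s\<rfloor>"
  define v where "v = (fst v0 - \<lfloor>s\<rfloor> * fst u, snd v0 - \<lfloor>s\<rfloor> * snd u)"
  define z where "z = (fst v - fst u, snd v - snd u)"
  have det: "fst u * snd v - snd u * fst v = 1" using v0 by (simp add: v_def algebra_simps)
  have uv: "real_vec v \<bullet> real_vec (perp u) = 1" using det by (rule inner_perp_unimodular)
  have vu: "real_vec u \<bullet> real_vec (perp v) = - 1"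
    using uv by (simp add: real_vec_def perp_def algebra_simps)
  have zz: "real_vec z = real_vec v - real_vec u" by (simp add: z_def real_vec_def)
  have pz: "real_vec (perp z) = real_vec (perp v) - real_vec (perp u)" by (simp add: z_def real_vec_def perp_def)
  have prim: "primitive v" "primitive z"
  proof -
    have "gcd (fst v) (snd v) dvd fst u * snd v - snd u * fst v" by (intro dvd_diff dvd_mult) auto
    thus "primitive v" using det by (simp add: primitive_def)
    have "gcd (fst z) (snd z) dvd fst u * snd z - snd u * fst z" by (intro dvd_diff dvd_mult) auto
    moreover have "fst u * snd z - snd u * fst z = 1" using det by (simp add: z_def algebra_simps)
    ultimately show "primitive z" by (simp add: primitive_def)
  qed
  have \<sigma>: "0 \<le> \<sigma>" "\<sigma> \<le> 1" unfolding \<sigma>_def by linarith+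
  have v_vec: "real_vec v = real_vec v0 - of_int \<lfloor>s\<rfloor> *\<^sub>R real_vec u" by (simp add: v_def real_vec_def)
  have slope: "real_vec v \<bullet> r - real_vec v \<bullet> l = \<sigma> * w"
  proof -
    have "s * w = real_vec v0 \<bullet> r - real_vec v0 \<bullet> l" using w(1) by (simp add: s_def)
    hence "real_vec v \<bullet> r - real_vec v \<bullet> l = s * w - of_int \<lfloor>s\<rfloor> * (real_vec u \<bullet> r - real_vec u \<bullet> l)"
      by (simp add: v_vec inner_diff_left algebra_simps)
    thus ?thesis by (simp add: w(2) \<sigma>_def left_diff_distrib)
  qed
  define X where "X x = real_vec u \<bullet> x - real_vec u \<bullet> l" for x
  define Y where "Y x = real_vec v \<bullet> x - real_vec v \<bullet> l" for x
  define b where "b = defect v"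
  define b' where "b' = defect z"
  have ab: "0 \<le> a" "0 \<le> b" "b \<le> a" "0 \<le> b'" "b' \<le> a"
    using u(2)[OF prim(1)] u(2)[OF prim(2)] by (auto simp: a_def b_def b'_def defect_def)
  \<comment> \<open>If \<open>w \<le> m\<close>, then \<open>w + a = m\<close>; otherwise all three
    defects vanish and the minimality of \<open>w\<close> gives the bounds.\<close>
  have wab: "w + a \<ge> real m" "face_width v \<ge> w + a - b" "face_width z \<ge> w + a - b'"
    using u(2)[OF prim(1)] u(2)[OF prim(2)] by (auto simp: w_def a_def b_def b'_def defect_def)
  define K where "K = (+) (- coords u v l) ` coords u v ` D"
  have D: "compact D" "convex D" unfolding D_def by (intro compact_dual_face fin convex_dual_face)+
  have K: "compact K" "convex K" unfolding K_def
    by (intro compact_translation convex_translation compact_coords convex_coords D)+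
  have area: "area K = area D" unfolding K_def by (simp only: area_translation area_coords[OF D(1) det])
  have K_eq: "K = (\<lambda>x. (X x, Y x)) ` D"
    unfolding K_def image_image by (intro image_cong) (auto simp: coords_def X_def Y_def)
  have KI: "(X x, Y x) \<in> K" if "x \<in> D" for x using that unfolding K_eq by blast
  obtain t where t: "t \<in> D" "t + b *\<^sub>R real_vec (perp v) \<in> D" "real_vec v \<bullet> t = supp v"
    unfolding D_def b_def using prim(1) by (rule top_side)
  obtain q where q: "q \<in> D" "q + b *\<^sub>R real_vec (perp v) \<in> D" "real_vec v \<bullet> q = - supp (- v)"
    unfolding D_def b_def using prim(1) by (rule bottom_side)
  obtain t' where t': "t' \<in> D" "real_vec z \<bullet> t' = supp z" unfolding D_def by (rule supp_point)
  obtain q' where q': "q' \<in> D" "real_vec (- z) \<bullet> q' = supp (- z)" unfolding D_def by (rule supp_point)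
  have shift: "X (x + \<rho> *\<^sub>R real_vec (perp u)) = X x" "Y (x + \<rho> *\<^sub>R real_vec (perp u)) = Y x + \<rho>"
    "X (x + \<rho> *\<^sub>R real_vec (perp v)) = X x - \<rho>" "Y (x + \<rho> *\<^sub>R real_vec (perp v)) = Y x" for x \<rho>
    by (simp_all add: X_def Y_def inner_add_right inner_perp uv vu)
  have Z: "Y x - X x = real_vec z \<bullet> x - real_vec z \<bullet> l" for x
    by (simp add: X_def Y_def zz inner_diff_left)
  have bounds: "- supp (- v') \<le> real_vec v' \<bullet> x" "real_vec v' \<bullet> x \<le> supp v'" if "x \<in> D" for v' x
    using that supp_ge supp_uminus_le by (auto simp: D_def)
  define Y1 where "Y1 = supp v - real_vec v \<bullet> l"
  define Y0 where "Y0 = - supp (- v) - real_vec v \<bullet> l"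
  define Z1 where "Z1 = supp z - real_vec z \<bullet> l"
  define Z0 where "Z0 = - supp (- z) - real_vec z \<bullet> l"
  \<comment> \<open>As \<open>u\<close> takes the value -1 on \<open>perp v\<close>, the horizontal
    sides run to the left from \<open>t\<close> and \<open>q\<close>; hence the abscissas
    \<open>X t - b\<close> and \<open>X q - b\<close>.\<close>
  have hyps: "(0, 0) \<in> K" "(0, a) \<in> K" "(w, \<sigma> * w) \<in> K" "(w, \<sigma> * w + a) \<in> K"
    "(X t - b, Y1) \<in> K" "(X t - b + b, Y1) \<in> K" "(X q - b, Y0) \<in> K" "(X q - b + b, Y0) \<in> K"
    "(X t', X t' + Z1) \<in> K" "(X q', X q' + Z0) \<in> K"
  proof -
    have "X l = 0" "Y l = 0" "X r = w" "Y r = \<sigma> * w" using w slope by (auto simp: X_def Y_def)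
    thus "(0, 0) \<in> K" "(0, a) \<in> K" "(w, \<sigma> * w) \<in> K" "(w, \<sigma> * w + a) \<in> K"
      using KI[OF l(1)] KI[OF l(2)] KI[OF r(1)] KI[OF r(2)] by (simp_all add: shift)
    have "Y t = Y1" "Y q = Y0" using t(3) q(3) by (auto simp: Y_def Y1_def Y0_def)
    thus "(X t - b, Y1) \<in> K" "(X t - b + b, Y1) \<in> K" "(X q - b, Y0) \<in> K" "(X q - b + b, Y0) \<in> K"
      using KI[OF t(1)] KI[OF t(2)] KI[OF q(1)] KI[OF q(2)] by (simp_all add: shift)
    have "Y t' = X t' + Z1" "Y q' = X q' + Z0"
      using Z[of t'] Z[of q'] t'(2) q'(2) by (auto simp: Z1_def Z0_def)
    thus "(X t', X t' + Z1) \<in> K" "(X q', X q' + Z0) \<in> K" using KI[OF t'(1)] KI[OF q'(1)] by auto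
  qed
  have ranges: "0 \<le> fst p" "fst p \<le> w" "snd p \<le> Y1" "Y0 \<le> snd p" "snd p - fst p \<le> Z1" "Z0 \<le> snd p - fst p"
    if "p \<in> K" for p
  proof -
    obtain x where x: "x \<in> D" "p = (X x, Y x)" using \<open>p \<in> K\<close> unfolding K_eq by blast
    show "0 \<le> fst p" "fst p \<le> w" "snd p \<le> Y1" "Y0 \<le> snd p" "snd p - fst p \<le> Z1" "Z0 \<le> snd p - fst p"
      using bounds[OF x(1), of u] bounds[OF x(1), of v] bounds[OF x(1), of z] l(3) Z[of x]
      by (auto simp: x(2) X_def Y_def Y1_def Y0_def Z1_def Z0_def w_def face_width_def)
  qed
  have diffs: "w + a - b \<le> Y1 - Y0" "w + a - b' \<le> Z1 - Z0"
    using wab by (auto simp: Y1_def Y0_def Z1_def Z0_def face_width_def)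
  note pb = planar_bound[OF K less_imp_le[OF w(1)] ab(1) \<sigma> ab(2-5) hyps(1-4) ranges(1,2) hyps(5,6) ranges(3)
      hyps(7,8) ranges(4) diffs(1) hyps(9) ranges(5) hyps(10) ranges(6) diffs(2)]
  have m2: "(real m)\<^sup>2 \<le> (w + a)\<^sup>2" using wab(1) by (intro power_mono) auto
  show ?thesis
  proof (rule that[of v z])
    show "area (dual_face A c P) + ((defect u)\<^sup>2 + (defect v)\<^sup>2 + (defect z)\<^sup>2) / 2 \<ge> 3 / 8 * (real m)\<^sup>2"
      using pb(1) m2 unfolding area D_def a_def b_def b'_def by simp
    show "2 * area (dual_face A c P) + (defect u)\<^sup>2 / 2 \<ge> (real m)\<^sup>2 / 2"
      using pb(2) m2 unfolding area D_def a_def by simp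
  qed (use prim vu uv in \<open>simp_all add: pz inner_diff_right inner_perp\<close>)
qed

end

section \<open>Summation over the vertex and three directions\<close>

theorem theorem2:
  fixes A :: "(int \<times> int) set" and c :: "int \<times> int \<Rightarrow> real"
    and P :: "real \<times> real" and m :: nat
  assumes "m > 0"
    and "finite A" and "A \<noteq> {}"
    and "min_lattice_width (newton_polygon A) \<ge> real m"
    and "P \<in> trop_vertices A c"
    and "trop_mult_eq A c P m"
  shows "infl_area_star A c P \<ge> 3 / 8 * (real m)\<^sup>2 \<and> infl_area A c P \<ge> 1 / 2 * (real m)\<^sup>2"
proof -
  interpret thick_vertex A c P m
    using assms by unfold_locales (auto simp: trop_mult_eq_def)
  obtain u where u: "primitive u" "\<And>v. primitive v \<Longrightarrow> face_width u \<le> face_width v"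
    using minimal_width_direction by blast
  obtain v z where vz: "primitive v" "primitive z"
    "real_vec u \<bullet> real_vec (perp v) \<noteq> 0" "real_vec u \<bullet> real_vec (perp z) \<noteq> 0" "real_vec v \<bullet> real_vec (perp z) \<noteq> 0"
    and bound: "area (dual_face A c P) + ((defect u)\<^sup>2 + (defect v)\<^sup>2 + (defect z)\<^sup>2) / 2 \<ge> 3 / 8 * (real m)\<^sup>2"
    "2 * area (dual_face A c P) + (defect u)\<^sup>2 / 2 \<ge> (real m)\<^sup>2 / 2"
    using dual_face_area_bounds[OF u] by blast
  define g where "g V = area (dual_face A c V)" for V
  define F where "F u = influenced_dir A c P u - {P}" for u
  have fin_I: "finite (influenced A c P)" using assms(2) by (rule finite_influenced)
  have FI: "F u \<subseteq> influenced A c P" if "primitive u" for u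
    using that unfolding F_def influenced_def by blast
  have "P \<in> influenced_dir A c P u"
    using assms(5) by (auto simp: influenced_dir_def long_edge_def trop_vertices_def dir_line_def
        connected_component_refl_eq intro: exI[of _ 0])
  hence PI: "P \<in> influenced A c P" using u(1) unfolding influenced_def by blast
  \<comment> \<open>Vertices on the three long edges other than \<open>P\<close> are distinct, so
    the area of \<open>d(P)\<close> and the three contributions add up.\<close>
  have disj: "F u \<inter> F v = {}" "(F u \<union> F v) \<inter> F z = {}"
    using influenced_dir_Int[OF vz(3), of A c P] influenced_dir_Int[OF vz(4), of A c P]
      influenced_dir_Int[OF vz(5), of A c P] by (auto simp: F_def)
  have finF: "finite (F u)" "finite (F v)" "finite (F z)"
    using FI u(1) vz(1,2) fin_I finite_subset by metis+
  have "sum g (insert P (F u \<union> F v \<union> F z)) \<le> sum g (influenced A c P)"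
    using FI[OF u(1)] FI[OF vz(1)] FI[OF vz(2)] PI by (intro sum_mono2 fin_I) (auto simp: g_def area_nonneg)
  also have "sum g (insert P (F u \<union> F v \<union> F z)) = g P + sum g (F u \<union> F v \<union> F z)"
    using finF by (intro sum.insert) (auto simp: F_def)
  also have "sum g (F u \<union> F v \<union> F z) = sum g (F u) + sum g (F v) + sum g (F z)"
    using finF disj by (simp add: sum.union_disjoint)
  finally have S: "g P + (sum g (F u) + sum g (F v) + sum g (F z)) \<le> infl_area_star A c P"
    by (simp add: infl_area_star_def g_def)
  have def: "(defect u)\<^sup>2 / 2 \<le> sum g (F u)" if "primitive u" for u
    using influenced_dir_defect[OF that assms(3,4)] by (simp add: g_def F_def)
  have pos: "0 \<le> sum g (F u)" for u by (intro sum_nonneg) (auto simp: g_def area_nonneg)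
  have "3 / 8 * (real m)\<^sup>2 \<le> infl_area_star A c P"
    using S bound(1) def[OF u(1)] def[OF vz(1)] def[OF vz(2)] by (simp add: g_def add_divide_distrib)
  \<comment> \<open>Counting \<open>d(P)\<close> twice matches the second area bound, which draws on
    the direction \<open>u\<close> alone.\<close>
  moreover have "1 / 2 * (real m)\<^sup>2 \<le> infl_area A c P"
    using S bound(2) def[OF u(1)] pos[of v] pos[of z] by (simp add: g_def infl_area_def)
  ultimately show ?thesis by blast
qed

end
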